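(* Let $d, r\in\mathbb{N}$. The linear functional $\nu^{(\infty,d)}$ on $\mathbb{C}\langle\{X_p\mid p\in\mathbb{N}\}\rangle$ is positive. The restriction of $\nu^{(\infty,d)}$ to the subalgebra $\mathbb{C}\langle X_1,\ldots,X_r\rangle$ of $\mathbb{C}\langle\{X_p\mid p\in\mathbb{N}\}\rangle$ is precisely equal to the joint GUE distribution $\nu^{(r,d)}\in\mathcal{D}_r$.
   Context: $\mathbb{N} = \{1,2,\ldots\}$. $S_\infty$ is the group of bijections $\tau : \mathbb{N}\to\mathbb{N}$ for which there is $k_o$ with $\tau(k)=k$ for all $k>k_o$; $\|\tau\|$ is the minimal number of transpositions in a factorization of $\tau$ into transpositions ($0$ for the identity); $\varphi_d : \mathbb{C}[S_\infty]\to\mathbb{C}$ is the linear functional with $\varphi_d(\tau)=(1/d)^{\|\tau\|}$ for $\tau\in S_\infty$; the $*$-operation on $\mathbb{C}[S_\infty]$ is determined by $\tau^*=\tau^{-1}$; $(\mathbb{C}[S_\infty],\varphi_d)$ is a $*$-probability space (unital $*$-algebra over $\mathbb{C}$ with a positive linear functional taking $1$ to $1$). The star-generators are $\gamma_n=(1,n+1)$, $n\in\mathbb{N}$. $\mathcal{P}(k)$ is the set of partitions of $\{1,\ldots,k\}$ ordered by reverse refinement ($\pi\le\rho$ iff every block of $\pi$ is contained in a block of $\rho$); $\mathcal{P}_2(k)$ is the set of those with all blocks of cardinality $2$ (empty for $k$ odd). For $\underline{i}\in\mathbb{N}^k$, $\mathrm{Ker}(\underline{i})\in\mathcal{P}(k)$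 is the partition of $\{1,\ldots,k\}$ into level sets of $\underline{i}$. The sequence $(\gamma_n)_{n=1}^\infty$ is exchangeable in $(\mathbb{C}[S_\infty],\varphi_d)$, i.e. $\varphi_d(\gamma_{\underline{i}(1)}\cdots\gamma_{\underline{i}(k)})$ depends only on $\mathrm{Ker}(\underline{i})$; its function on partitions $\mathbf{u}_d : \sqcup_{k=1}^\infty\mathcal{P}(k)\to\mathbb{C}$ is $\mathbf{u}_d(\pi) := \varphi_d(\gamma_{\underline{i}(1)}\cdots\gamma_{\underline{i}(k)})$ for any $\underline{i}\in\mathbb{N}^k$ with $\mathrm{Ker}(\underline{i})=\pi$. $\mathbb{C}\langle\{X_p\mid p\in\mathbb{N}\}\rangle$ is the algebra of polynomials in countably many non-commuting indeterminates, with the $*$-operation determined by $X_p^*=X_p$; a functional $\nu$ is positive if $\nu(P^*P)\ge0$ for all $P$. The functional $\nu^{(\infty,d)}$ is the linear functional with $\nu^{(\infty,d)}(1)=1$ and, for all $k\in\mathbb{N}$, $\underline{i}\in\mathbb{N}^k$, $$\nu^{(\infty,d)}(X_{\underline{i}(1)}\cdots X_{\underline{i}(k)}) = \sum_{\pi\in\mathcal{P}_2(k),\ \pi\le\mathrm{Ker}(\underline{i})}\mathbf{u}_d(\pi)$$ (an empty sum being $0$). $\mathcal{D}_r$ is the set of positive linear functionals $\mu$ on $\mathbb{C}\langle X_1,\ldots,X_r\rangle$ with $\mu(1)=1$. $\nu^{(r,d)} \in \mathcal{D}_r$ is defined by $\nu^{(r,d)}(X_{i(1)}\cdots X_{i(k)})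 = E(\mathrm{tr}_d(M_{i(1)}\cdots M_{i(k)}))$ for all $k\in\mathbb{N}$, $(i(1),\ldots,i(k))\in\{1,\ldots,r\}^k$, where $\mathrm{tr}_d$ is the normalized trace on $d\times d$ matrices, $E$ is the expectation, and $M_1,\ldots,M_r$ are $d\times d$ GUE random matrices of variance $1$ with independent entries: $M_n$ is selfadjoint, with $(i,i)$-entry $\xi_{i,i}^{(n)}$, and for $i<j$ with $(i,j)$-entry $\xi_{i,j}^{(n)}+\sqrt{-1}\,\eta_{i,j}^{(n)}$ and $(j,i)$-entry $\xi_{i,j}^{(n)}-\sqrt{-1}\,\eta_{i,j}^{(n)}$, where all the $\xi_{i,j}^{(n)}$ ($i\le j$) and $\eta_{i,j}^{(n)}$ ($i<j$), over all $n$, are independent centered real Gaussian random variables with $\mathrm{Var}(\xi_{i,i}^{(n)})=1/d$ and $\mathrm{Var}(\xi_{i,j}^{(n)})=\mathrm{Var}(\eta_{i,j}^{(n)})=1/(2d)$ for $i<j$. *)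

theory Defs
  imports
    "HOL-Probability.Probability"
    "HOL-Library.Poly_Mapping"
    "HOL-Library.Disjoint_Sets"
    "HOL-Combinatorics.Combinatorics"
    "Jordan_Normal_Form.Matrix"
begin

subsection \<open>Monoid algebras\<close>

text \<open>
  With coefficients in \<^typ>\<open>complex\<close>, the type \<open>'m \<Rightarrow>\<^sub>0 complex\<close> with the convolution product
  of \<^theory>\<open>HOL-Library.Poly_Mapping\<close> is the monoid algebra of \<open>'m\<close>. That product is indexed by
  \<^class>\<open>monoid_add\<close>, which is not assumed commutative, so the group \<open>S\<^sub>\<infinity>\<close> and the free monoid
  of words are both written additively below.
\<close>

definition linear_extension :: "('m \<Rightarrow> complex) \<Rightarrow> ('m \<Rightarrow>\<^sub>0 complex) \<Rightarrow> complex" where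
  "linear_extension f P = (\<Sum>m\<in>Poly_Mapping.keys P. Poly_Mapping.lookup P m * f m)"

lemma linear_extension_single: "linear_extension f (Poly_Mapping.single m c) = c * f m"
  by (simp add: linear_extension_def)


subsection \<open>The group \<open>S\<^sub>\<infinity>\<close>\<close>

text \<open>A bijection of \<open>{1, 2, \<dots>}\<close> is represented by its extension to \<^typ>\<open>nat\<close> that fixes \<open>0\<close>.\<close>

typedef s_inf = "{\<tau> :: nat \<Rightarrow> nat. bij \<tau> \<and> \<tau> 0 = 0 \<and> (\<exists>k0. \<forall>k>k0. \<tau> k = k)}"
  morphisms s_apply S_inf
  by (rule exI[of _ id]) auto

setup_lifting type_definition_s_inf

instantiation s_inf :: group_add
begin

lift_definition zero_s_inf :: s_inf is id
  by auto

lift_definition plus_s_inf :: "s_inf \<Rightarrow> s_inf \<Rightarrow> s_inf" is "(\<circ>)"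
proof -
  fix f g :: "nat \<Rightarrow> nat"
  assume f: "bij f \<and> f 0 = 0 \<and> (\<exists>k0. \<forall>k>k0. f k = k)"
    and g: "bij g \<and> g 0 = 0 \<and> (\<exists>k0. \<forall>k>k0. g k = k)"
  then obtain k l where "\<forall>i>k. f i = i" "\<forall>i>l. g i = i"
    by blast
  then have "\<forall>i>max k l. (f \<circ> g) i = i"
    by simp
  then show "bij (f \<circ> g) \<and> (f \<circ> g) 0 = 0 \<and> (\<exists>k0. \<forall>k>k0. (f \<circ> g) k = k)"
    using f g by (intro conjI exI[of _ "max k l"]) (auto intro: bij_comp)
qed

lift_definition uminus_s_inf :: "s_inf \<Rightarrow> s_inf" is "inv_into UNIV"
proof -
  fix f :: "nat \<Rightarrow> nat"
  assume f: "bij f \<and> f 0 = 0 \<and> (\<exists>k0. \<forall>k>k0. f k = k)"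
  then have "inv_into UNIV f k = k" if "f k = k" for k
    using that by (metis bij_inv_eq_iff)
  with f show "bij (inv_into UNIV f) \<and> inv_into UNIV f 0 = 0 \<and> (\<exists>k0. \<forall>k>k0. inv_into UNIV f k = k)"
    by (auto intro: bij_imp_bij_inv)
qed

definition minus_s_inf :: "s_inf \<Rightarrow> s_inf \<Rightarrow> s_inf" where
  "minus_s_inf \<sigma> \<tau> = \<sigma> + - \<tau>"

instance
proof
  fix a b c :: s_inf
  show "a + b + c = a + (b + c)"
    by transfer (simp add: comp_assoc)
  show "0 + a = a" "a + 0 = a"
    by (transfer, simp)+
  show "- a + a = 0"
    by transfer (simp add: bij_is_inj)
  show "a + - b = a - b"
    by (simp add: minus_s_inf_def)
qed

end

lift_definition s_transpose :: "nat \<Rightarrow> nat \<Rightarrow> s_inf" is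
  "\<lambda>a b. if 1 \<le> a \<and> 1 \<le> b then Transposition.transpose a b else id"
proof -
  fix a b :: nat
  have "\<forall>k>max a b. Transposition.transpose a b k = k"
    by auto
  then show "bij (if 1 \<le> a \<and> 1 \<le> b then Transposition.transpose a b else id) \<and>
      (if 1 \<le> a \<and> 1 \<le> b then Transposition.transpose a b else id) 0 = 0 \<and>
      (\<exists>k0. \<forall>k>k0. (if 1 \<le> a \<and> 1 \<le> b then Transposition.transpose a b else id) k = k)"
    by (intro conjI exI[of _ "max a b"]) auto
qed

definition s_transpositions :: "s_inf set" where
  "s_transpositions = {s_transpose a b | a b. 1 \<le> a \<and> 1 \<le> b \<and> a \<noteq> b}"

definition s_length :: "s_inf \<Rightarrow> nat" where
  "s_length \<tau> = (LEAST n. \<exists>ts. length ts = n \<and> set ts \<subseteq> s_transpositions \<and> sum_list ts = \<tau>)"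

definition phi :: "nat \<Rightarrow> (s_inf \<Rightarrow>\<^sub>0 complex) \<Rightarrow> complex" where
  "phi d = linear_extension (\<lambda>\<tau>. (1 / of_nat d) ^ s_length \<tau>)"

definition star_generator :: "nat \<Rightarrow> s_inf \<Rightarrow>\<^sub>0 complex" where
  "star_generator n = Poly_Mapping.single (s_transpose 1 (n + 1)) 1"


subsection \<open>Partitions\<close>

text \<open>
  A tuple in \<open>\<nat>\<^sup>k\<close> is a list of length \<open>k\<close> with positive entries; its component at the position
  \<open>j \<in> {1..k}\<close> is the list entry with index \<open>j - 1\<close>.
\<close>

definition tuple_kernel :: "nat list \<Rightarrow> nat set set" where
  "tuple_kernel is = (\<lambda>m. {j \<in> {1..length is}. is ! (j - 1) = m}) ` set is"

definition pair_partitions :: "nat \<Rightarrow> nat set set set" where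
  "pair_partitions k = {\<pi>. partition_on {1..k} \<pi> \<and> (\<forall>B\<in>\<pi>. card B = 2)}"

text \<open>The choice of the tuple is immaterial, see \<open>u_fun_tuple_kernel\<close>.\<close>

definition u_fun :: "nat \<Rightarrow> nat set set \<Rightarrow> complex" where
  "u_fun d \<pi> = phi d (prod_list (map star_generator
     (SOME is. set is \<subseteq> {1..} \<and> tuple_kernel is = \<pi>)))"

lemma prod_list_star_generator:
  "prod_list (map star_generator is) =
     Poly_Mapping.single (sum_list (map (\<lambda>n. s_transpose 1 (n + 1)) is)) 1"
  by (induction "is") (simp_all add: star_generator_def mult_single)

lemma phi_star_generators:
  "phi d (prod_list (map star_generator is)) =
     (1 / of_nat d) ^ s_length (sum_list (map (\<lambda>n. s_transpose 1 (n + 1)) is))"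
  by (simp add: phi_def prod_list_star_generator linear_extension_single)

lemma Union_tuple_kernel: "\<Union> (tuple_kernel is) = {1..length is}"
proof -
  have "is ! (j - 1) \<in> set is" if "j \<in> {1..length is}" for j
    using that by (intro nth_mem) auto
  then show ?thesis
    by (auto simp: tuple_kernel_def)
qed

lemma tuple_kernel_eqD:
  assumes "tuple_kernel is = tuple_kernel js"
  shows "length is = length js"
    and "\<And>i j. i < length is \<Longrightarrow> j < length is \<Longrightarrow> is ! i = is ! j \<longleftrightarrow> js ! i = js ! j"
proof -
  have "{1..length is} = {1..length js}"
    using assms Union_tuple_kernel by metis
  then show len: "length is = length js"
    by (metis card_atLeastAtMost diff_Suc_1)
  have *: "xs ! i = xs ! j \<longleftrightarrow> (\<exists>B\<in>tuple_kernel xs. Suc i \<in> B \<and> Suc j \<in> B)"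
    if "i < length xs" "j < length xs" for xs i j
    using that by (auto simp: tuple_kernel_def)
  show "is ! i = is ! j \<longleftrightarrow> js ! i = js ! j" if "i < length is" "j < length is" for i j
    using *[of i "is" j] *[of i js j] that len assms by simp
qed

lemma s_transpose_conj:
  assumes "1 \<le> a" "1 \<le> b"
  shows "\<sigma> + s_transpose a b + - \<sigma> = s_transpose (s_apply \<sigma> a) (s_apply \<sigma> b)"
  using assms
proof transfer
  fix a b :: nat and \<sigma> :: "nat \<Rightarrow> nat"
  assume a: "1 \<le> a" "1 \<le> b" and \<sigma>: "bij \<sigma> \<and> \<sigma> 0 = 0 \<and> (\<exists>k0. \<forall>k>k0. \<sigma> k = k)"
  then have "1 \<le> \<sigma> a" "1 \<le> \<sigma> b"
    by (metis bij_pointE less_one not_less)+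
  moreover have "\<sigma> \<circ> Transposition.transpose a b \<circ> inv_into UNIV \<sigma> = Transposition.transpose (\<sigma> a) (\<sigma> b)"
  proof
    fix x
    obtain y where y: "x = \<sigma> y"
      using \<sigma> by (metis bij_pointE)
    have "inv_into UNIV \<sigma> (\<sigma> y) = y"
      using \<sigma> by (simp add: bij_is_inj)
    then show "(\<sigma> \<circ> Transposition.transpose a b \<circ> inv_into UNIV \<sigma>) x =
        Transposition.transpose (\<sigma> a) (\<sigma> b) x"
      using \<sigma> by (auto simp: y Transposition.transpose_def bij_is_inj inj_eq)
  qed
  ultimately show "\<sigma> \<circ> (if 1 \<le> a \<and> 1 \<le> b then Transposition.transpose a b else id) \<circ> inv_into UNIV \<sigma> =
      (if 1 \<le> \<sigma> a \<and> 1 \<le> \<sigma> b then Transposition.transpose (\<sigma> a) (\<sigma> b) else id)"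
    using a by simp
qed

lemma sum_list_conj:
  fixes \<sigma> :: "'g :: group_add"
  shows "\<sigma> + sum_list ts + - \<sigma> = sum_list (map (\<lambda>t. \<sigma> + t + - \<sigma>) ts)"
proof (induction ts)
  case (Cons t ts)
  have "\<sigma> + sum_list (t # ts) + - \<sigma> = (\<sigma> + t + - \<sigma>) + (\<sigma> + sum_list ts + - \<sigma>)"
    by (simp add: add.assoc del: add_uminus_conv_diff)
  with Cons show ?case
    by simp
qed simp

lemma s_length_conj: "s_length (\<sigma> + \<tau> + - \<sigma>) = s_length \<tau>"
proof -
  define F where "F n \<tau> \<longleftrightarrow> (\<exists>ts. length ts = n \<and> set ts \<subseteq> s_transpositions \<and> sum_list ts = \<tau>)"
    for n \<tau>
  have conj: "\<sigma> + t + - \<sigma> \<in> s_transpositions" if t: "t \<in> s_transpositions" for \<sigma> t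
  proof -
    obtain a b where ab: "t = s_transpose a b" "1 \<le> a" "1 \<le> b" "a \<noteq> b"
      using t by (auto simp: s_transpositions_def)
    have "bij (s_apply \<sigma>)" "s_apply \<sigma> 0 = 0"
      using s_apply[of \<sigma>] by auto
    then have "s_apply \<sigma> a \<noteq> s_apply \<sigma> b" "s_apply \<sigma> a \<noteq> 0" "s_apply \<sigma> b \<noteq> 0"
      using ab by (metis bij_is_inj inj_eq not_one_le_zero)+
    then show ?thesis
      unfolding ab(1) s_transpose_conj[OF ab(2,3)] s_transpositions_def by fastforce
  qed
  have imp: "F n (\<sigma> + \<tau> + - \<sigma>)" if F: "F n \<tau>" for n \<sigma> \<tau>
  proof -
    obtain ts where "length ts = n" "set ts \<subseteq> s_transpositions" "sum_list ts = \<tau>"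
      using F unfolding F_def by blast
    then show ?thesis
      unfolding F_def using conj
      by (intro exI[of _ "map (\<lambda>t. \<sigma> + t + - \<sigma>) ts"])
        (auto simp: sum_list_conj simp del: add_uminus_conv_diff)
  qed
  have "F n (\<sigma> + \<tau> + - \<sigma>) \<longleftrightarrow> F n \<tau>" for n
    using imp[of n \<tau> \<sigma>] imp[of n "\<sigma> + \<tau> + - \<sigma>" "- \<sigma>"]
    by (auto simp: add.assoc simp del: add_uminus_conv_diff)
  then show ?thesis
    by (simp add: s_length_def flip: F_def)
qed

lemma star_generators_exchangeable:
  assumes "set is \<subseteq> {1..}" "set js \<subseteq> {1..}" "tuple_kernel is = tuple_kernel js"
  shows "phi d (prod_list (map star_generator is)) = phi d (prod_list (map star_generator js))"
proof -
  note len = tuple_kernel_eqD(1)[OF assms(3)] and eq = tuple_kernel_eqD(2)[OF assms(3)]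
  define ix where "ix a = (SOME j. j < length is \<and> is ! j = a)" for a
  have ix: "ix a < length is" "is ! ix a = a" if "a \<in> set is" for a
    using someI_ex[of "\<lambda>j. j < length is \<and> is ! j = a"] that
    by (auto simp: ix_def in_set_conv_nth)
  define g where "g a = js ! ix a" for a
  have g: "g (is ! j) = js ! j" if "j < length is" for j
    using eq[of "ix (is ! j)" j] ix[of "is ! j"] that by (simp add: g_def)
  have js: "map g is = js"
    using len g by (auto intro: nth_equalityI)
  have inj: "inj_on g (set is)"
    by (auto simp: inj_on_def in_set_conv_nth g eq)
  define A B where "A = set is" and "B = set js"
  have bij1: "bij_betw g A B"
    using inj js unfolding A_def B_def bij_betw_def by (metis list.set_map)
  then have "card A = card B"
    by (rule bij_betw_same_card)
  then have "card (B - A) = card (A - B)"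
    by (simp add: A_def B_def card_Diff_subset_Int Int_commute)
  then obtain h where h: "bij_betw h (B - A) (A - B)"
    by (metis A_def B_def List.finite_set finite_Diff finite_same_card_bij)
  define p where "p a = (if a \<in> A then g a else if a \<in> B then h a else a)" for a
  have "bij_betw p A B" "bij_betw p (B - A) (A - B)"
    using bij1 h by (subst bij_betw_cong; force simp: p_def)+
  then have "bij_betw p (A \<union> (B - A)) (B \<union> (A - B))"
    by (rule bij_betw_combine) auto
  then have "bij_betw p (A \<union> B) (A \<union> B)"
    by (simp add: Un_commute)
  then have p: "p permutes A \<union> B"
    by (rule bij_imp_permutes) (auto simp: p_def)
  have AB: "A \<union> B \<subseteq> {1..}" "finite (A \<union> B)"
    using assms by (auto simp: A_def B_def)
  have p0: "p 0 = 0"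
    using AB by (auto simp: p_def)
  have bijp: "bij p"
    using p by (rule permutes_bij)
  define s where "s n = (case n of 0 \<Rightarrow> 0 | Suc m \<Rightarrow> Suc (p m))" for n
  have s_simps: "s 0 = 0" "s (Suc m) = Suc (p m)" for m
    by (auto simp: s_def)
  have s1: "s 1 = 1"
    by (simp add: s_simps p0)
  have "bij s"
  proof (rule o_bij)
    let ?t = "\<lambda>n. case n of 0 \<Rightarrow> 0 | Suc m \<Rightarrow> Suc (inv_into UNIV p m)"
    show "?t \<circ> s = id" "s \<circ> ?t = id"
      using bijp by (auto simp: fun_eq_iff s_def bij_is_inj bij_is_surj surj_f_inv_f split: nat.splits)
  qed
  moreover have "\<exists>k0. \<forall>k>k0. s k = k"
  proof (intro exI allI impI)
    fix k assume k: "k > Suc (Max (insert 0 (A \<union> B)))"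
    then obtain m where m: "k = Suc m"
      by (cases k) auto
    have "m \<notin> A \<union> B"
      using k AB(2) m by (metis Max_ge Suc_less_eq finite.insertI insertI2 not_less)
    then show "s k = k"
      using m by (simp add: s_simps p_def)
  qed
  ultimately have s: "s_apply (S_inf s) = s"
    by (simp add: S_inf_inverse s_simps)
  have "S_inf s + sum_list (map (\<lambda>n. s_transpose 1 (n + 1)) is) + - S_inf s =
      sum_list (map (\<lambda>n. s_transpose (s 1) (s (n + 1))) is)"
    by (simp add: sum_list_conj s_transpose_conj s comp_def del: add_uminus_conv_diff)
  also have "map (\<lambda>n. s_transpose (s 1) (s (n + 1))) is =
      map (\<lambda>n. s_transpose 1 (n + 1)) (map g is)"
    using s1 by (auto simp: s_simps p_def A_def)
  finally show ?thesis
    unfolding js phi_star_generators by (metis s_length_conj)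
qed

lemma u_fun_tuple_kernel:
  assumes "set is \<subseteq> {1..}"
  shows "u_fun d (tuple_kernel is) = phi d (prod_list (map star_generator is))"
proof -
  have "set (SOME js. set js \<subseteq> {1..} \<and> tuple_kernel js = tuple_kernel is) \<subseteq> {1..} \<and>
      tuple_kernel (SOME js. set js \<subseteq> {1..} \<and> tuple_kernel js = tuple_kernel is) = tuple_kernel is"
    by (rule someI[where x = "is"]) (use assms in simp)
  then show ?thesis
    unfolding u_fun_def using assms by (intro star_generators_exchangeable) auto
qed


subsection \<open>Non-commutative polynomials\<close>

datatype nc_word = Word (letters: "nat list")

instantiation nc_word :: monoid_add
begin

definition zero_nc_word :: nc_word where
  "0 = Word []"

definition plus_nc_word :: "nc_word \<Rightarrow> nc_word \<Rightarrow> nc_word" where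
  "v + w = Word (letters v @ letters w)"

instance
  by standard (auto simp: zero_nc_word_def plus_nc_word_def)

end

type_synonym nc_poly = "nc_word \<Rightarrow>\<^sub>0 complex"

text \<open>
  \<open>nc_polys I\<close> is the algebra of polynomials in the indeterminates \<open>X\<^sub>p\<close> with \<open>p \<in> I\<close>; the algebra
  in the indeterminates indexed by \<open>{1, 2, \<dots>}\<close> is \<open>nc_polys {1..}\<close>, as the type itself has an
  extra \<open>X\<^sub>0\<close>.
\<close>

definition nc_polys :: "nat set \<Rightarrow> nc_poly set" where
  "nc_polys I = {P. \<forall>w\<in>Poly_Mapping.keys P. set (letters w) \<subseteq> I}"

definition nc_var :: "nat \<Rightarrow> nc_poly" where
  "nc_var p = Poly_Mapping.single (Word [p]) 1"

lift_definition nc_star :: "nc_poly \<Rightarrow> nc_poly" is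
  "\<lambda>P w. cnj (P (Word (rev (letters w))))"
proof -
  fix P :: "nc_word \<Rightarrow> complex"
  assume "finite {w. P w \<noteq> 0}"
  moreover have "{w. cnj (P (Word (rev (letters w)))) \<noteq> 0} \<subseteq>
      (\<lambda>w. Word (rev (letters w))) ` {w. P w \<noteq> 0}"
  proof
    fix w assume "w \<in> {w. cnj (P (Word (rev (letters w)))) \<noteq> 0}"
    then show "w \<in> (\<lambda>w. Word (rev (letters w))) ` {w. P w \<noteq> 0}"
      by (intro image_eqI[where x = "Word (rev (letters w))"]) auto
  qed
  ultimately show "finite {w. cnj (P (Word (rev (letters w)))) \<noteq> 0}"
    by (meson finite_imageI finite_subset)
qed

definition linear_functional_on :: "nc_poly set \<Rightarrow> (nc_poly \<Rightarrow> complex) \<Rightarrow> bool" where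
  "linear_functional_on A \<mu> \<longleftrightarrow>
     (\<forall>P\<in>A. \<forall>Q\<in>A. \<mu> (P + Q) = \<mu> P + \<mu> Q) \<and>
     (\<forall>c. \<forall>P\<in>A. \<mu> (Poly_Mapping.map ((*) c) P) = c * \<mu> P)"

definition positive_functional_on :: "nc_poly set \<Rightarrow> (nc_poly \<Rightarrow> complex) \<Rightarrow> bool" where
  "positive_functional_on A \<mu> \<longleftrightarrow> (\<forall>P\<in>A. \<mu> (nc_star P * P) \<in> \<real>\<^sub>\<ge>\<^sub>0)"

text \<open>Functionals with domain \<open>nc_polys {1..r}\<close> are normalised to be \<^const>\<open>undefined\<close> outside it.\<close>

definition distributions :: "nat \<Rightarrow> (nc_poly \<Rightarrow> complex) set" where
  "distributions r = {\<mu> \<in> extensional (nc_polys {1..r}).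
     linear_functional_on (nc_polys {1..r}) \<mu> \<and>
     positive_functional_on (nc_polys {1..r}) \<mu> \<and> \<mu> 1 = 1}"

lemma prod_list_nc_var: "prod_list (map nc_var is) = Poly_Mapping.single (Word is) 1"
proof (induction "is")
  case Nil
  then show ?case
    by (simp flip: zero_nc_word_def)
next
  case (Cons p "is")
  then show ?case
    by (simp add: nc_var_def mult_single plus_nc_word_def)
qed


subsection \<open>The functional \<open>\<nu>\<^sup>(\<^sup>\<infinity>\<^sup>,\<^sup>d\<^sup>)\<close>\<close>

definition nu_inf_moment :: "nat \<Rightarrow> nat list \<Rightarrow> complex" where
  "nu_inf_moment d is =
     (if is = [] then 1
      else (\<Sum>\<pi> | \<pi> \<in> pair_partitions (length is) \<and>
                 refines {1..length is} \<pi> (tuple_kernel is). u_fun d \<pi>))"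

definition nu_inf :: "nat \<Rightarrow> nc_poly \<Rightarrow> complex" where
  "nu_inf d = linear_extension (\<lambda>w. nu_inf_moment d (letters w))"

lemma nu_inf_monomial: "nu_inf d (prod_list (map nc_var is)) = nu_inf_moment d is"
  by (simp add: nu_inf_def prod_list_nc_var linear_extension_single)


subsection \<open>The joint GUE distribution\<close>

text \<open>
  \<open>\<xi> n i j\<close> and \<open>\<eta> n i j\<close> are the real and imaginary parts of the entries of the \<open>n\<close>-th matrix.
  Rows and columns are numbered from \<open>0\<close>, as in \<^theory>\<open>Jordan_Normal_Form.Matrix\<close>; the matrices
  themselves are numbered from \<open>1\<close>. The variables \<open>\<xi> n i j\<close> with \<open>i \<le> j\<close> and \<open>\<eta> n i j\<close> with
  \<open>i < j\<close> are collected into one family indexed by a sum type, so that joint independence of all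
  of them can be stated. Note that \<^const>\<open>normal_density\<close> takes the standard deviation.
\<close>

definition gue_entries ::
  "'w measure \<Rightarrow> nat \<Rightarrow> nat \<Rightarrow> (nat \<Rightarrow> nat \<Rightarrow> nat \<Rightarrow> 'w \<Rightarrow> real) \<Rightarrow>
   (nat \<Rightarrow> nat \<Rightarrow> nat \<Rightarrow> 'w \<Rightarrow> real) \<Rightarrow> bool" where
  "gue_entries \<Omega> d r \<xi> \<eta> \<longleftrightarrow>
     prob_space \<Omega> \<and>
     prob_space.indep_vars \<Omega> (\<lambda>_. borel)
       (case_sum (\<lambda>(n, i, j). \<xi> n i j) (\<lambda>(n, i, j). \<eta> n i j))
       ({(n, i, j). n \<in> {1..r} \<and> i \<le> j \<and> j < d} <+> {(n, i, j). n \<in> {1..r} \<and> i < j \<and> j < d}) \<and>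
     (\<forall>n\<in>{1..r}.
       (\<forall>i<d. distributed \<Omega> lborel (\<xi> n i i) (normal_density 0 (sqrt (1 / real d)))) \<and>
       (\<forall>i j. i < j \<and> j < d \<longrightarrow>
          distributed \<Omega> lborel (\<xi> n i j) (normal_density 0 (sqrt (1 / (2 * real d)))) \<and>
          distributed \<Omega> lborel (\<eta> n i j) (normal_density 0 (sqrt (1 / (2 * real d))))))"

definition gue_matrix ::
  "nat \<Rightarrow> (nat \<Rightarrow> nat \<Rightarrow> nat \<Rightarrow> 'w \<Rightarrow> real) \<Rightarrow> (nat \<Rightarrow> nat \<Rightarrow> nat \<Rightarrow> 'w \<Rightarrow> real) \<Rightarrow>
   nat \<Rightarrow> 'w \<Rightarrow> complex mat" where
  "gue_matrix d \<xi> \<eta> n \<omega> = Matrix.mat d d (\<lambda>(i, j).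
     if i = j then complex_of_real (\<xi> n i i \<omega>)
     else if i < j then Complex (\<xi> n i j \<omega>) (\<eta> n i j \<omega>)
     else Complex (\<xi> n j i \<omega>) (- \<eta> n j i \<omega>))"

definition normalized_trace :: "nat \<Rightarrow> complex mat \<Rightarrow> complex" where
  "normalized_trace d A = (\<Sum>i<d. A $$ (i, i)) / of_nat d"

text \<open>
  \<^const>\<open>prod_list\<close> is not available because the type of matrices of all sizes has no unit; the
  empty product is the identity matrix, so the empty word has moment \<open>1\<close>.
\<close>

definition gue_moment ::
  "'w measure \<Rightarrow> nat \<Rightarrow> (nat \<Rightarrow> nat \<Rightarrow> nat \<Rightarrow> 'w \<Rightarrow> real) \<Rightarrow>
   (nat \<Rightarrow> nat \<Rightarrow> nat \<Rightarrow> 'w \<Rightarrow> real) \<Rightarrow> nat list \<Rightarrow> complex" where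
  "gue_moment \<Omega> d \<xi> \<eta> is = prob_space.expectation \<Omega>
     (\<lambda>\<omega>. normalized_trace d (foldr (\<lambda>n A. gue_matrix d \<xi> \<eta> n \<omega> * A) is (1\<^sub>m d)))"

definition gue_distribution ::
  "'w measure \<Rightarrow> nat \<Rightarrow> nat \<Rightarrow> (nat \<Rightarrow> nat \<Rightarrow> nat \<Rightarrow> 'w \<Rightarrow> real) \<Rightarrow>
   (nat \<Rightarrow> nat \<Rightarrow> nat \<Rightarrow> 'w \<Rightarrow> real) \<Rightarrow> nc_poly \<Rightarrow> complex" where
  "gue_distribution \<Omega> d r \<xi> \<eta> =
     restrict (linear_extension (\<lambda>w. gue_moment \<Omega> d \<xi> \<eta> (letters w))) (nc_polys {1..r})"

end

theory Submission
  imports Defs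
begin

text \<open>
  Expanding the trace of a product of GUE matrices as a sum over closed walks of indices
  \<open>j 0, \<dots>, j k\<close> and applying Wick's formula turns a moment into a sum over pair partitions \<open>\<pi>\<close>
  of the letters, each weighted with \<open>d\<close> to the power \<open>- 1 - k / 2\<close> times the number of closed
  walks compatible with \<open>\<pi>\<close>. Following the point \<open>1\<close> through a product of star transpositions with
  kernel \<open>\<pi>\<close> puts these walks in bijection with the \<open>d\<close>-colourings of \<open>{1, \<dots>, k / 2 + 1}\<close> that are
  invariant under the product, and for every permutation \<open>\<sigma>\<close> of a set \<open>S\<close> there are \<open>d\<close> to the
  power \<open>card S - \<parallel>\<sigma>\<parallel>\<close> invariant colourings. Hence the weight is the value of \<open>u_fun d\<close> at \<open>\<pi>\<close>.
  Positivity is inherited from the GUE, as \<open>tr (P(M)* P(M)) \<ge> 0\<close> and a polynomial contains only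
  finitely many indeterminates.
\<close>

subsection \<open>Colourings invariant under a permutation\<close>

text \<open>The weight matches because the normalized trace contributes one factor
  \<open>1 / d\<close> and each of the \<open>k / 2\<close> covariances another. These
  \<open>k / 2 + 1\<close> factors cancel \<open>d\<close> to the power \<open>card S\<close> in the
  colouring count, and \<open>d\<close> to the power minus \<open>s_length\<close> remains. The
  obstacle is \<open>s_length\<close>, a minimum over all factorizations, including those that pass
  through points outside \<open>S\<close>. An explicit factorization gives an upper bound, but
  \<open>d\<close>-colourings cannot give the lower one in general, since for \<open>d = 1\<close>
  every count is \<open>1\<close>. The lower bound is therefore proved with two colours, on a point
  set enlarged by the points that the competing factorization moves. Counting colourings also avoids
  cycle decompositions: orbits appear only as exponents. Positivity is claimed without reference to
  any probability space, so GUE entries have to be constructed for every number of matrices.\<close>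

definition invariant_colourings :: "nat \<Rightarrow> nat set \<Rightarrow> (nat \<Rightarrow> nat) \<Rightarrow> (nat \<Rightarrow> nat) set" where
  "invariant_colourings d S \<sigma> = {f \<in> S \<rightarrow>\<^sub>E {..<d}. \<forall>x\<in>S. f (\<sigma> x) = f x}"

lemma finite_invariant_colourings: "finite S \<Longrightarrow> finite (invariant_colourings d S \<sigma>)"
  unfolding invariant_colourings_def by (rule finite_subset[OF _ finite_PiE[of S "\<lambda>_. {..<d}"]]) auto

text \<open>A fixed point is an orbit of its own, so its colour is free.\<close>

lemma card_invariant_colourings_insert_fixed:
  assumes "x \<notin> S" "\<sigma> permutes S"
  shows "card (invariant_colourings d (insert x S) \<sigma>) = d * card (invariant_colourings d S \<sigma>)"
proof -
  have \<sigma>: "\<sigma> x = x" "\<And>y. y \<in> S \<Longrightarrow> \<sigma> y \<in> S"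
    using assms by (auto simp: permutes_def permutes_in_image)
  have "invariant_colourings d (insert x S) \<sigma> =
      (\<lambda>(y, g). g(x := y)) ` ({..<d} \<times> invariant_colourings d S \<sigma>)"
  proof (intro equalityI subsetI)
    fix f assume f: "f \<in> invariant_colourings d (insert x S) \<sigma>"
    then have "f(x := undefined) \<in> invariant_colourings d S \<sigma>"
      using assms(1) \<sigma> fun_upd_in_PiE[of x S f] by (auto simp: invariant_colourings_def)
    moreover have "f x < d"
      using f by (auto simp: invariant_colourings_def)
    ultimately show "f \<in> (\<lambda>(y, g). g(x := y)) ` ({..<d} \<times> invariant_colourings d S \<sigma>)"
      by (intro image_eqI[where x = "(f x, f(x := undefined))"]) auto
  next
    fix f assume "f \<in> (\<lambda>(y, g). g(x := y)) ` ({..<d} \<times> invariant_colourings d S \<sigma>)"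
    then show "f \<in> invariant_colourings d (insert x S) \<sigma>"
      using assms(1) \<sigma> by (auto simp: invariant_colourings_def intro!: PiE_fun_upd)
  qed
  moreover have "inj_on (\<lambda>(y, g). g(x := y)) ({..<d} \<times> invariant_colourings d S \<sigma>)"
    by (rule inj_on_subset[OF inj_combinator[OF assms(1), of "\<lambda>_. {..<d}"]])
      (auto simp: invariant_colourings_def)
  ultimately show ?thesis
    by (simp add: card_image card_cartesian_product)
qed

lemma card_invariant_colourings_Un_fixed:
  assumes "finite T" "S \<inter> T = {}" "\<sigma> permutes S"
  shows "card (invariant_colourings d (S \<union> T) \<sigma>) = d ^ card T * card (invariant_colourings d S \<sigma>)"
  using assms
proof (induction T rule: finite_induct)
  case (insert x T)
  have "\<sigma> permutes S \<union> T"
    using insert.prems permutes_subset by blast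
  then show ?case
    using insert card_invariant_colourings_insert_fixed[of x "S \<union> T" \<sigma> d] by simp
qed simp

text \<open>The transposition cuts \<open>x\<close> out of its cycle: \<open>x\<close> becomes fixed
  and the preimage of \<open>x\<close> is sent directly to \<open>\<sigma> x\<close>.\<close>

lemma permutes_transpose_comp:
  assumes "x \<notin> S" "\<sigma> permutes insert x S"
  shows "Transposition.transpose x (\<sigma> x) \<circ> \<sigma> permutes S"
proof -
  have "Transposition.transpose x (\<sigma> x) permutes insert x S"
    using permutes_in_image[OF assms(2), of x] by (intro permutes_swap_id) auto
  then have "Transposition.transpose x (\<sigma> x) \<circ> \<sigma> permutes insert x S"
    using assms permutes_compose by blast
  then show ?thesis
    by (rule permutes_superset) (auto simp: Transposition.transpose_def)
qed

text \<open>The colour of \<open>x\<close> is forced by that of \<open>\<sigma> x\<close>, and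
  cutting \<open>x\<close> out of a cycle with other points does not change the number of orbits. In
  the fixed case an orbit disappears together with \<open>x\<close>.\<close>

lemma card_invariant_colourings_insert_moved:
  assumes "x \<notin> S" "\<sigma> permutes insert x S" "\<sigma> x \<noteq> x"
  shows "card (invariant_colourings d (insert x S) \<sigma>) =
    card (invariant_colourings d S (Transposition.transpose x (\<sigma> x) \<circ> \<sigma>))"
proof -
  have mem: "\<sigma> y \<in> insert x S \<longleftrightarrow> y \<in> insert x S" for y
    using assms(2) by (rule permutes_in_image)
  have inj: "\<sigma> y = \<sigma> z \<longleftrightarrow> y = z" for y z
    using assms(2) by (metis permutes_inj injD)
  have \<sigma>x: "\<sigma> x \<in> S"
    using mem[of x] assms(3) by auto
  have trans: "(Transposition.transpose x (\<sigma> x) \<circ> \<sigma>) y = (if \<sigma> y = x then \<sigma> x else \<sigma> y)" if "y \<in> S" for y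
    using that assms(1) inj[of y x] by (auto simp: Transposition.transpose_def)
  have "bij_betw (\<lambda>f. restrict f S) (invariant_colourings d (insert x S) \<sigma>)
      (invariant_colourings d S (Transposition.transpose x (\<sigma> x) \<circ> \<sigma>))"
  proof (rule bij_betw_byWitness[where f' = "\<lambda>g. g(x := g (\<sigma> x))"])
    show "\<forall>f\<in>invariant_colourings d (insert x S) \<sigma>. (restrict f S)(x := restrict f S (\<sigma> x)) = f"
      using assms(1) \<sigma>x
      by (force simp: invariant_colourings_def fun_eq_iff PiE_def extensional_def)
    show "\<forall>g\<in>invariant_colourings d S (Transposition.transpose x (\<sigma> x) \<circ> \<sigma>).
        restrict (g(x := g (\<sigma> x))) S = g"
      using assms(1) by (auto simp: invariant_colourings_def fun_eq_iff PiE_def extensional_def)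
    show "(\<lambda>f. restrict f S) ` invariant_colourings d (insert x S) \<sigma> \<subseteq>
        invariant_colourings d S (Transposition.transpose x (\<sigma> x) \<circ> \<sigma>)"
    proof clarify
      fix f assume f: "f \<in> invariant_colourings d (insert x S) \<sigma>"
      have "f (if \<sigma> y = x then \<sigma> x else \<sigma> y) = f y" "(if \<sigma> y = x then \<sigma> x else \<sigma> y) \<in> S" if "y \<in> S" for y
        using f that \<sigma>x mem[of y] by (auto simp: invariant_colourings_def)
      then show "restrict f S \<in> invariant_colourings d S (Transposition.transpose x (\<sigma> x) \<circ> \<sigma>)"
        using f by (auto simp: invariant_colourings_def trans simp del: comp_apply)
    qed
    show "(\<lambda>g. g(x := g (\<sigma> x))) ` invariant_colourings d S (Transposition.transpose x (\<sigma> x) \<circ> \<sigma>) \<subseteq>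
        invariant_colourings d (insert x S) \<sigma>"
    proof clarify
      fix g assume g: "g \<in> invariant_colourings d S (Transposition.transpose x (\<sigma> x) \<circ> \<sigma>)"
      have "g (if \<sigma> y = x then \<sigma> x else \<sigma> y) = g y" if "y \<in> S" for y
        using g that trans[OF that] by (auto simp: invariant_colourings_def)
      then show "g(x := g (\<sigma> x)) \<in> invariant_colourings d (insert x S) \<sigma>"
        using g \<sigma>x assms(1,3) by (force simp: invariant_colourings_def intro!: PiE_fun_upd)
    qed
  qed
  then show ?thesis
    by (rule bij_betw_same_card)
qed

lemma s_apply_transpose:
  "1 \<le> a \<Longrightarrow> 1 \<le> b \<Longrightarrow> s_apply (s_transpose a b) = Transposition.transpose a b"
  by (simp add: s_transpose.rep_eq)

text \<open>
  Splitting off one point at a time produces a factorization of length \<open>card S - c\<close>, where \<open>c\<close> is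
  the number of orbits and \<open>d\<^sup>c\<close> the number of invariant colourings.
\<close>

lemma ex_transposition_factorization:
  assumes "finite S" "0 \<notin> S" "s_apply \<tau> permutes S"
  shows "\<exists>ts. set ts \<subseteq> s_transpositions \<and> sum_list ts = \<tau> \<and>
    (\<forall>d. card (invariant_colourings d S (s_apply \<tau>)) * d ^ length ts = d ^ card S)"
  using assms
proof (induction S arbitrary: \<tau> rule: finite_induct)
  case empty
  then have "\<tau> = 0"
    by (simp add: zero_s_inf.rep_eq flip: s_apply_inject)
  then show ?case
    by (intro exI[of _ "[]"]) (auto simp: invariant_colourings_def)
next
  case (insert x S)
  show ?case
  proof (cases "s_apply \<tau> x = x")
    case True
    then have "s_apply \<tau> permutes S"
      using insert.prems(2) by (auto intro: permutes_superset)
    with insert obtain ts where ts: "set ts \<subseteq> s_transpositions" "sum_list ts = \<tau>"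
        "\<And>d. card (invariant_colourings d S (s_apply \<tau>)) * d ^ length ts = d ^ card S"
      by (metis insertI2)
    then show ?thesis
      using insert.hyps \<open>s_apply \<tau> permutes S\<close>
      by (intro exI[of _ ts]) (simp add: card_invariant_colourings_insert_fixed mult.assoc)
  next
    case False
    define t where "t = s_transpose x (s_apply \<tau> x)"
    have pos: "1 \<le> x" "1 \<le> s_apply \<tau> x"
      using insert.prems permutes_in_image[OF insert.prems(2), of x]
      by (metis insertI1 less_one not_less)+
    have \<tau>': "s_apply (t + \<tau>) = Transposition.transpose x (s_apply \<tau> x) \<circ> s_apply \<tau>"
      using s_apply_transpose[OF pos] by (simp add: t_def plus_s_inf.rep_eq)
    then have "s_apply (t + \<tau>) permutes S"
      using permutes_transpose_comp[OF insert.hyps(2) insert.prems(2)] by simp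
    with insert obtain ts where ts: "set ts \<subseteq> s_transpositions" "sum_list ts = t + \<tau>"
        "\<And>d. card (invariant_colourings d S (s_apply (t + \<tau>))) * d ^ length ts = d ^ card S"
      by (metis insertI2)
    have "t + t = 0"
      unfolding s_apply_inject[symmetric]
      using s_apply_transpose[OF pos] by (simp add: t_def plus_s_inf.rep_eq zero_s_inf.rep_eq)
    then have "t + (t + \<tau>) = \<tau>"
      by (metis add.assoc add_0)
    moreover have "t \<in> s_transpositions"
      unfolding t_def s_transpositions_def using pos False
      by (intro CollectI exI[of _ x] exI[of _ "s_apply \<tau> x"]) auto
    \<comment> \<open>A moved point costs one transposition and brings no new orbit, so both
      exponents of \<open>d\<close> grow by one.\<close>
    moreover have "card (invariant_colourings d (insert x S) (s_apply \<tau>)) * d ^ Suc (length ts) =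
        d ^ card (insert x S)" for d
      using ts(3)[of d] insert.hyps False
      by (simp add: card_invariant_colourings_insert_moved[OF insert.hyps(2) insert.prems(2)]
          \<tau>' mult.left_commute)
    ultimately show ?thesis
      using ts by (intro exI[of _ "t # ts"]) simp
  qed
qed

text \<open>
  Two-colourings form a vector space over the field with two elements, and each transposition
  imposes one linear equation.
\<close>

lemma card_two_colourings_ge:
  assumes "finite S" "set ts \<subseteq> s_transpositions" "\<forall>t\<in>set ts. s_apply t permutes S"
  shows "2 ^ card S \<le> card {f \<in> S \<rightarrow>\<^sub>E {..<2::nat}. \<forall>t\<in>set ts. \<forall>x\<in>S. f (s_apply t x) = f x} * 2 ^ length ts"
  using assms
proof (induction ts)
  case Nil
  then show ?case
    by (simp add: card_funcsetE)
next
  case (Cons t ts)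
  define G where "G us = {f \<in> S \<rightarrow>\<^sub>E {..<2::nat}. \<forall>t\<in>set us. \<forall>x\<in>S. f (s_apply t x) = f x}" for us
  have finG: "finite (G us)" for us
    unfolding G_def by (rule finite_subset[OF _ finite_PiE[of S "\<lambda>_. {..<2}"]]) (use Cons in auto)
  obtain a b where ab: "t = s_transpose a b" "1 \<le> a" "1 \<le> b" "a \<noteq> b"
    using Cons.prems(2) by (auto simp: s_transpositions_def)
  have st: "s_apply t = Transposition.transpose a b"
    using ab by (simp add: s_apply_transpose)
  have abS: "a \<in> S" "b \<in> S"
    using Cons.prems(3) ab(4) permutes_not_in[of "s_apply t" S a] permutes_not_in[of "s_apply t" S b]
    by (auto simp: st)
  have eq: "G (t # ts) = {f \<in> G ts. f a = f b}"
    using abS by (auto simp: G_def st Transposition.transpose_def)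
  \<comment> \<open>At least half of the colourings that satisfy \<open>ts\<close> also satisfy
    \<open>f a = f b\<close>: adding one fixed violator \<open>g\<close> modulo 2 maps the violators
    injectively to solutions.\<close>
  have le: "card {f \<in> G ts. f a \<noteq> f b} \<le> card {f \<in> G ts. f a = f b}"
  proof (cases "{f \<in> G ts. f a \<noteq> f b} = {}")
    case False
    then obtain g where g: "g \<in> G ts" "g a \<noteq> g b"
      by auto
    let ?\<Phi> = "\<lambda>f. \<lambda>x\<in>S. (f x + g x) mod 2"
    have lt2: "f x < 2" if "f \<in> G us" "x \<in> S" for f x us
      using that by (auto simp: G_def)
    have sum01: "(f a + g a) mod 2 = (f b + g b) mod 2" if "f \<in> G ts" "f a \<noteq> f b" for f
      using lt2[OF that(1) abS(1)] lt2[OF that(1) abS(2)] lt2[OF g(1) abS(1)] lt2[OF g(1) abS(2)]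
        that(2) g(2) by presburger
    show ?thesis
    proof (rule card_inj_on_le[where f = ?\<Phi>])
      show "inj_on ?\<Phi> {f \<in> G ts. f a \<noteq> f b}"
      proof (rule inj_onI)
        fix f h assume f: "f \<in> {f \<in> G ts. f a \<noteq> f b}" and h: "h \<in> {f \<in> G ts. f a \<noteq> f b}"
          and eq: "?\<Phi> f = ?\<Phi> h"
        have "f x = h x" if "x \<in> S" for x
        proof -
          have "(f x + g x) mod 2 = (h x + g x) mod 2"
            using fun_cong[OF eq, of x] that by simp
          then show ?thesis
            using lt2[of f ts x] lt2[of h ts x] f h that by simp presburger
        qed
        then show "f = h"
          using f h by (intro PiE_ext[of f S "\<lambda>_. {..<2}" h]) (auto simp: G_def)
      qed
      show "?\<Phi> ` {f \<in> G ts. f a \<noteq> f b} \<subseteq> {f \<in> G ts. f a = f b}"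
      proof clarify
        fix f assume f: "f \<in> G ts" "f a \<noteq> f b"
        have "s_apply t x \<in> S" if "t \<in> set ts" "x \<in> S" for t x
          using Cons.prems(3) that by (simp add: permutes_in_image)
        then have "?\<Phi> f \<in> G ts"
          using f g by (auto simp: G_def)
        then show "?\<Phi> f \<in> G ts \<and> ?\<Phi> f a = ?\<Phi> f b"
          using sum01[OF f] abS by simp
      qed
      show "finite {f \<in> G ts. f a = f b}"
        using finG by simp
    qed
  next
    case True
    then show ?thesis
      by (metis (mono_tags, lifting) card.empty le0)
  qed
  have "2 ^ card S \<le> card (G ts) * 2 ^ length ts"
    using Cons unfolding G_def by simp
  also have "G ts = {f \<in> G ts. f a = f b} \<union> {f \<in> G ts. f a \<noteq> f b}"
    by auto
  also have "card \<dots> = card {f \<in> G ts. f a = f b} + card {f \<in> G ts. f a \<noteq> f b}"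
    using finG by (intro card_Un_disjoint) auto
  also have "\<dots> * 2 ^ length ts \<le> card (G (t # ts)) * 2 ^ length (t # ts)"
    using le by (simp add: eq)
  finally show ?case
    unfolding G_def .
qed

text \<open>Invariance under every factor implies invariance under the product. The converse can
  fail, for instance when factors cancel, hence only an inequality.\<close>

lemma card_two_colourings_sum_list_ge:
  assumes "finite S" "set ts \<subseteq> s_transpositions" "\<forall>t\<in>set ts. s_apply t permutes S"
  shows "2 ^ card S \<le> card (invariant_colourings 2 S (s_apply (sum_list ts))) * 2 ^ length ts"
proof -
  have "f (s_apply (sum_list ts) x) = f x"
    if "\<forall>t\<in>set ts. \<forall>x\<in>S. f (s_apply t x) = f x" "x \<in> S" for f :: "nat \<Rightarrow> nat" and x
    using that assms(3)
  proof (induction ts arbitrary: x)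
    case (Cons t ts)
    have "s_apply (sum_list ts) permutes S"
      using Cons.prems(3)
    proof (induction ts)
      case Nil
      then show ?case
        using permutes_id by (simp add: zero_s_inf.rep_eq id_def)
    next
      case (Cons u us)
      then have "s_apply (sum_list us) permutes S" "s_apply u permutes S"
        by auto
      then show ?case
        using permutes_compose by (simp add: plus_s_inf.rep_eq del: comp_apply) blast
    qed
    then have "s_apply (sum_list ts) x \<in> S"
      using Cons.prems(2) by (simp add: permutes_in_image)
    then show ?case
      using Cons by (simp add: plus_s_inf.rep_eq)
  qed (simp add: zero_s_inf.rep_eq)
  then have "{f \<in> S \<rightarrow>\<^sub>E {..<2::nat}. \<forall>t\<in>set ts. \<forall>x\<in>S. f (s_apply t x) = f x} \<subseteq>
      invariant_colourings 2 S (s_apply (sum_list ts))"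
    by (auto simp: invariant_colourings_def)
  then have "card {f \<in> S \<rightarrow>\<^sub>E {..<2::nat}. \<forall>t\<in>set ts. \<forall>x\<in>S. f (s_apply t x) = f x} \<le>
      card (invariant_colourings 2 S (s_apply (sum_list ts)))"
    using assms(1) finite_invariant_colourings card_mono by blast
  then show ?thesis
    using card_two_colourings_ge[OF assms] by (meson le_trans mult_le_mono1)
qed

text \<open>The factorization obtained by splitting off points is minimal, because the two-colour
  bound applies to every competitor \<open>us\<close>. As \<open>ts\<close> does not depend on the
  number of colours, minimality shown with two colours settles every \<open>d\<close>.\<close>

lemma card_invariant_colourings:
  assumes "finite S" "0 \<notin> S" "s_apply \<tau> permutes S"
  shows "card (invariant_colourings d S (s_apply \<tau>)) * d ^ s_length \<tau> = d ^ card S"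
proof -
  obtain ts where ts: "set ts \<subseteq> s_transpositions" "sum_list ts = \<tau>"
      "\<And>d. card (invariant_colourings d S (s_apply \<tau>)) * d ^ length ts = d ^ card S"
    using ex_transposition_factorization[OF assms] by blast
  have "length ts \<le> length us" if us: "set us \<subseteq> s_transpositions" "sum_list us = \<tau>" for us
  proof -
    \<comment> \<open>A competitor may use points outside \<open>S\<close>; \<open>T\<close>
      contains everything that its factors move.\<close>
    have "\<exists>T. finite T \<and> (\<forall>t\<in>set us. s_apply t permutes T)"
      using us(1)
    proof (induction us)
      case (Cons t us)
      then obtain T where T: "finite T" "\<forall>t\<in>set us. s_apply t permutes T"
        by auto
      obtain a b where ab: "t = s_transpose a b" "1 \<le> a" "1 \<le> b"
        using Cons.prems by (auto simp: s_transpositions_def)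
      then have "s_apply t permutes {a, b}"
        by (simp add: s_apply_transpose permutes_swap_id)
      then show ?case
        using T by (intro exI[of _ "{a, b} \<union> T"]) (auto intro: permutes_subset)
    qed auto
    then obtain T where T: "finite T" "\<forall>t\<in>set us. s_apply t permutes T"
      by blast
    \<comment> \<open>Each point of \<open>T - S\<close> is fixed by \<open>\<tau>\<close> and
      doubles the count, so both factorizations can be compared on
      \<open>S \<union> T\<close>.\<close>
    define N where "N = card (invariant_colourings 2 (S \<union> T) (s_apply \<tau>))"
    have "N = 2 ^ card (T - S) * card (invariant_colourings 2 S (s_apply \<tau>))"
      using card_invariant_colourings_Un_fixed[of "T - S" S "s_apply \<tau>" 2] T assms
      by (simp add: N_def)
    then have "N * 2 ^ length ts = 2 ^ (card S + card (T - S))"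
      using ts(3)[of 2] by (simp add: power_add)
    also have "card S + card (T - S) = card (S \<union> T)"
      using T assms by (metis Un_Diff_cancel card_Un_disjoint Diff_disjoint finite_Diff)
    also have "2 ^ card (S \<union> T) \<le> N * 2 ^ length us"
      using card_two_colourings_sum_list_ge[of "S \<union> T" us] us T assms
      by (auto simp: N_def intro: permutes_subset)
    finally have "N * 2 ^ length ts \<le> N * 2 ^ length us" .
    moreover have "N > 0"
      using \<open>N * 2 ^ length ts = 2 ^ (card S + card (T - S))\<close> by (metis gr0I mult_0 power_not_zero zero_neq_numeral)
    ultimately show ?thesis
      by simp
  qed
  then have "s_length \<tau> = length ts"
    unfolding s_length_def using ts by (intro Least_equality) auto
  then show ?thesis
    using ts(3) by simp
qed

subsection \<open>Closed walks and products of star transpositions\<close>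

text \<open>The element whose \<open>s_length\<close> occurs in \<open>phi_star_generators\<close>.
  Addition in \<open>s_inf\<close> is composition, so the last letter acts first and appending a
  letter composes on the right.\<close>

definition star_product :: "nat list \<Rightarrow> s_inf" where
  "star_product is = sum_list (map (\<lambda>n. s_transpose 1 (n + 1)) is)"

lemma s_apply_star_product_Nil: "s_apply (star_product []) = id"
  by (simp add: star_product_def zero_s_inf.rep_eq)

lemma s_apply_star_product_snoc:
  "s_apply (star_product (is @ [p])) = s_apply (star_product is) \<circ> Transposition.transpose 1 (Suc p)"
  by (simp add: star_product_def plus_s_inf.rep_eq s_transpose.rep_eq)

lemma star_product_permutes:
  "set is \<subseteq> I \<Longrightarrow> s_apply (star_product is) permutes insert 1 (Suc ` I)"
proof (induction "is" rule: rev_induct)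
  case Nil
  then show ?case
    using permutes_id by (simp add: s_apply_star_product_Nil id_def)
next
  case (snoc p ps)
  then have "Transposition.transpose 1 (Suc p) permutes insert 1 (Suc ` I)"
    by (intro permutes_swap_id) auto
  then show ?case
    unfolding s_apply_star_product_snoc using snoc by (intro permutes_compose) auto
qed

text \<open>
  Pairs \<open>{s, t}\<close> of positions correspond to the covariance of the matrix entries with indices
  \<open>(j (s - 1), j s)\<close> and \<open>(j (t - 1), j t)\<close>.
\<close>

definition closed_walks :: "nat \<Rightarrow> nat \<Rightarrow> nat set set \<Rightarrow> (nat \<Rightarrow> nat) set" where
  "closed_walks d k \<pi> = {j \<in> {..k} \<rightarrow>\<^sub>E {..<d}. j 0 = j k \<and>
     (\<forall>B\<in>\<pi>. \<forall>s\<in>B. \<forall>t\<in>B. s \<noteq> t \<longrightarrow> j (s - 1) = j t)}"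

text \<open>Blocks count positions from 1 and lists from 0: the witnesses are the two elements of
  the block of \<open>p\<close>, in increasing order and lowered by one.\<close>

lemma pair_kernel_positions:
  assumes "\<forall>B\<in>tuple_kernel is. card B = 2" "p \<in> set is"
  shows "\<exists>s t. s < t \<and> t < length is \<and> (\<forall>a<length is. is ! a = p \<longleftrightarrow> a = s \<or> a = t)"
proof -
  let ?B = "{j \<in> {1..length is}. is ! (j - 1) = p}"
  have "card ?B = 2"
    using assms by (auto simp: tuple_kernel_def)
  then obtain u v where "?B = {u, v}" "u \<noteq> v"
    unfolding card_2_iff by blast
  then obtain x y where xy: "?B = {x, y}" "x < y"
    using that[of u v] that[of v u] by (cases "u < v") (simp_all add: insert_commute)
  have B: "a \<in> {1..length is} \<and> is ! (a - 1) = p \<longleftrightarrow> a = x \<or> a = y" for a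
    using xy(1) by blast
  have "1 \<le> x" "y \<le> length is"
    using B[of x] B[of y] by auto
  moreover have "is ! a = p \<longleftrightarrow> a = x - 1 \<or> a = y - 1" if "a < length is" for a
    using B[of "Suc a"] that \<open>1 \<le> x\<close> xy(2) by auto
  ultimately show ?thesis
    using xy(2) by (intro exI[of _ "x - 1"] exI[of _ "y - 1"]) auto
qed

text \<open>
  Apply the transpositions \<open>(1, i\<^sub>a + 1)\<close> one by one to an invariant colouring \<open>f\<close> and let \<open>j a\<close> be
  the colour of the point \<open>1\<close> after \<open>a\<close> steps. Since every point \<open>p + 1\<close> is swapped with \<open>1\<close> exactly
  twice, \<open>j\<close> determines \<open>f\<close>, and the possible \<open>j\<close> are exactly the closed walks.
\<close>

lemma card_closed_walks:
  assumes pos: "set is \<subseteq> {1..}" and pairs: "\<forall>B\<in>tuple_kernel is. card B = 2"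
  shows "card (closed_walks d (length is) (tuple_kernel is)) =
    card (invariant_colourings d (insert 1 (Suc ` set is)) (s_apply (star_product is)))"
proof -
  define k where "k = length is"
  define S where "S = insert 1 (Suc ` set is)"
  \<comment> \<open>\<open>g f a\<close> is the colouring after \<open>a\<close> steps; by
    \<open>g_Suc\<close> the next step exchanges the colours at \<open>1\<close> and at
    \<open>is ! a + 1\<close>.\<close>
  define g where "g f a x = f (s_apply (star_product (take a is)) x)" for f :: "nat \<Rightarrow> nat" and a x
  have "\<exists>s t. \<forall>p\<in>set is. s p < t p \<and> t p < k \<and> (\<forall>a<k. is ! a = p \<longleftrightarrow> a = s p \<or> a = t p)"
    using pair_kernel_positions[OF pairs] unfolding k_def by metis
  then obtain s t where st: "\<And>p. p \<in> set is \<Longrightarrow> s p < t p" "\<And>p. p \<in> set is \<Longrightarrow> t p < k"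
      "\<And>p a. p \<in> set is \<Longrightarrow> a < k \<Longrightarrow> is ! a = p \<longleftrightarrow> a = s p \<or> a = t p"
    by blast
  have sk: "s p < k" if "p \<in> set is" for p
    using st(1,2)[OF that] by simp
  have nth_st: "is ! s p = p" "is ! t p = p" if "p \<in> set is" for p
    using st(3)[OF that sk[OF that]] st(3)[OF that st(2)[OF that]] by auto
  have nth_mem': "is ! a \<in> set is" if "a < k" for a
    using that by (simp add: k_def)
  have p_pos: "0 < p" if "p \<in> set is" for p
    using that pos by auto
  have g_0: "g f 0 x = f x" for f x
    by (simp add: g_def s_apply_star_product_Nil)
  have g_k: "g f k x = f (s_apply (star_product is) x)" for f x
    by (simp add: g_def k_def)
  have g_Suc: "g f (Suc a) x = g f a (Transposition.transpose 1 (Suc (is ! a)) x)" if "a < k" for f a x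
    using that by (simp add: g_def k_def take_Suc_conv_app_nth s_apply_star_product_snoc)
  have g_range: "g f a x < d" if "f \<in> S \<rightarrow>\<^sub>E {..<d}" "x \<in> S" for f a x
  proof -
    have "s_apply (star_product (take a is)) x \<in> S"
      using that(2) star_product_permutes[of "take a is" "set is"]
      by (metis S_def permutes_in_image set_take_subset)
    then show ?thesis
      using that(1) by (auto simp: g_def)
  qed
  \<comment> \<open>The colour at \<open>p + 1\<close> changes only when the letter \<open>p\<close>
    is read.\<close>
  have g_const: "g f b (Suc p) = g f a (Suc p)"
    if "a \<le> b" "b \<le> k" "p \<in> set is" "\<And>c. a \<le> c \<Longrightarrow> c < b \<Longrightarrow> is ! c \<noteq> p" for f a b p
    using that(1,2,4)
  proof (induction b rule: dec_induct)
    case (step b)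
    then have "g f (Suc b) (Suc p) = g f b (Suc p)"
      using p_pos[OF that(3)] by (subst g_Suc) (auto simp: Transposition.transpose_def)
    with step show ?case
      by simp
  qed simp
  \<comment> \<open>Each \<open>p + 1\<close> is visited twice. The first visit brings its original
    colour to \<open>1\<close> (\<open>B1\<close>) and leaves the colour of \<open>1\<close> there.
    The second visit brings that colour back (\<open>B2\<close>), and the colour that
    \<open>1\<close> had just before stays at \<open>p + 1\<close> to the end (\<open>B3\<close>).
    \<open>B2\<close> holds for every \<open>f\<close>; by \<open>B1\<close> and \<open>B3\<close>
    the other walk equation expresses invariance at \<open>p + 1\<close>, while
    \<open>j 0 = j k\<close> expresses invariance at \<open>1\<close>.\<close>
  have B1: "g f (Suc (s p)) 1 = f (Suc p)" if p: "p \<in> set is" for f p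
  proof -
    have "g f (Suc (s p)) 1 = g f (s p) (Suc p)"
      using g_Suc[OF sk[OF p]] nth_st[OF p] by simp
    also have "\<dots> = g f 0 (Suc p)"
      using st[OF p] sk[OF p] by (intro g_const) (auto simp: p)
    finally show ?thesis
      by (simp add: g_0)
  qed
  have B2: "g f (Suc (t p)) 1 = g f (s p) 1" if p: "p \<in> set is" for f p
  proof -
    have "g f (Suc (t p)) 1 = g f (t p) (Suc p)"
      using g_Suc[OF st(2)[OF p]] nth_st[OF p] by simp
    also have "\<dots> = g f (Suc (s p)) (Suc p)"
      using st[OF p] sk[OF p] by (intro g_const) (auto simp: p)
    also have "\<dots> = g f (s p) 1"
      using g_Suc[OF sk[OF p]] nth_st[OF p] by simp
    finally show ?thesis .
  qed
  have B3: "g f k (Suc p) = g f (t p) 1" if p: "p \<in> set is" for f p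
  proof -
    have "g f k (Suc p) = g f (Suc (t p)) (Suc p)"
      using st[OF p] sk[OF p] by (intro g_const) (auto simp: p)
    also have "\<dots> = g f (t p) 1"
      using g_Suc[OF st(2)[OF p]] nth_st[OF p] by simp
    finally show ?thesis .
  qed
  \<comment> \<open>Positions in blocks are counted from 1, so the block of \<open>p\<close> couples
    the walk steps from \<open>s p\<close> to \<open>Suc (s p)\<close> and from \<open>t p\<close>
    to \<open>Suc (t p)\<close>, in opposite directions.\<close>
  have walks: "j \<in> closed_walks d k (tuple_kernel is) \<longleftrightarrow> j \<in> {..k} \<rightarrow>\<^sub>E {..<d} \<and> j 0 = j k \<and>
      (\<forall>p\<in>set is. j (s p) = j (Suc (t p)) \<and> j (t p) = j (Suc (s p)))" for j
  proof -
    have "{a \<in> {1..length is}. is ! (a - 1) = p} = {Suc (s p), Suc (t p)}" if "p \<in> set is" for p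
    proof (rule Set.set_eqI)
      fix a
      show "a \<in> {a \<in> {1..length is}. is ! (a - 1) = p} \<longleftrightarrow> a \<in> {Suc (s p), Suc (t p)}"
        using st(2)[OF that] st(3)[OF that, of "a - 1"] sk[OF that] by (cases a) (auto simp: k_def nth_st that)
    qed
    then have "tuple_kernel is = (\<lambda>p. {Suc (s p), Suc (t p)}) ` set is"
      by (simp add: tuple_kernel_def)
    then have "(\<forall>B\<in>tuple_kernel is. \<forall>a\<in>B. \<forall>b\<in>B. a \<noteq> b \<longrightarrow> j (a - 1) = j b) \<longleftrightarrow>
        (\<forall>p\<in>set is. \<forall>a\<in>{Suc (s p), Suc (t p)}. \<forall>b\<in>{Suc (s p), Suc (t p)}. a \<noteq> b \<longrightarrow> j (a - 1) = j b)"
      by simp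
    also have "\<dots> \<longleftrightarrow> (\<forall>p\<in>set is. j (s p) = j (Suc (t p)) \<and> j (t p) = j (Suc (s p)))"
    proof (rule ball_cong[OF refl])
      fix p assume "p \<in> set is"
      then show "(\<forall>a\<in>{Suc (s p), Suc (t p)}. \<forall>b\<in>{Suc (s p), Suc (t p)}. a \<noteq> b \<longrightarrow> j (a - 1) = j b) \<longleftrightarrow>
          j (s p) = j (Suc (t p)) \<and> j (t p) = j (Suc (s p))"
        using st(1)[of p] by auto
    qed
    finally show ?thesis
      by (simp add: closed_walks_def)
  qed
  \<comment> \<open>The inverse reads the colour of \<open>p + 1\<close> off the walk right after
    the first visit, as \<open>B1\<close> dictates; \<open>x - 1\<close> is the letter belonging to
    the point \<open>x\<close>.\<close>
  define \<Psi> where "\<Psi> j = (\<lambda>x\<in>S. if x = 1 then j 0 else j (Suc (s (x - 1))))" for j :: "nat \<Rightarrow> nat"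
  have \<Psi>1: "\<Psi> j 1 = j 0" for j
    by (simp add: \<Psi>_def S_def)
  have \<Psi>_Suc: "\<Psi> j (Suc p) = j (Suc (s p))" if "p \<in> set is" for j p
    using that p_pos[OF that] by (simp add: \<Psi>_def S_def)
  \<comment> \<open>The induction is strong because a second visit refers back to time
    \<open>s p\<close> by \<open>B2\<close>; a first visit is settled by \<open>B1\<close>
    alone.\<close>
  have walk_of: "g (\<Psi> j) a 1 = j a" if j: "j \<in> closed_walks d k (tuple_kernel is)" and "a \<le> k" for j a
    using that(2)
  proof (induction a rule: less_induct)
    case (less a)
    show ?case
    proof (cases a)
      case 0
      then show ?thesis
        using \<Psi>1 by (simp add: g_0)
    next
      case (Suc b)
      let ?p = "is ! b"
      have p: "?p \<in> set is"
        using less.prems Suc by (intro nth_mem') simp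
      then have "b = s ?p \<or> b = t ?p"
        using st(3)[of ?p b] less.prems Suc by simp
      then show ?thesis
      proof
        assume b: "b = s ?p"
        have "g (\<Psi> j) (Suc (s ?p)) 1 = j (Suc (s ?p))"
          using B1[OF p] \<Psi>_Suc[OF p] by simp
        with b Suc show ?thesis
          by simp
      next
        assume b: "b = t ?p"
        have "g (\<Psi> j) (Suc (t ?p)) 1 = j (s ?p)"
          using B2[OF p, of "\<Psi> j"] less.IH[of "s ?p"] less.prems Suc st(1)[OF p] b by simp
        moreover have "j (s ?p) = j (Suc (t ?p))"
          using j p walks by blast
        ultimately show ?thesis
          using b Suc by simp
      qed
    qed
  qed
  have "bij_betw (\<lambda>f. \<lambda>a\<in>{..k}. g f a 1) (invariant_colourings d S (s_apply (star_product is)))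
      (closed_walks d k (tuple_kernel is))"
  proof (rule bij_betw_byWitness[where f' = \<Psi>])
    show "\<forall>f\<in>invariant_colourings d S (s_apply (star_product is)). \<Psi> (\<lambda>a\<in>{..k}. g f a 1) = f"
    proof
      fix f assume f: "f \<in> invariant_colourings d S (s_apply (star_product is))"
      have "\<Psi> (\<lambda>a\<in>{..k}. g f a 1) x = f x" if "x \<in> S" for x
      proof (cases "x = 1")
        case True
        then show ?thesis
          using \<Psi>1 by (simp add: g_0)
      next
        case False
        then obtain p where p: "x = Suc p" "p \<in> set is"
          using \<open>x \<in> S\<close> by (auto simp: S_def)
        then show ?thesis
          using \<Psi>_Suc[OF p(2)] B1[OF p(2)] sk[OF p(2)] by simp
      qed
      moreover have "f x = undefined" if "x \<notin> S" for x
        using f that by (auto simp: invariant_colourings_def)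
      ultimately show "\<Psi> (\<lambda>a\<in>{..k}. g f a 1) = f"
        by (auto simp: fun_eq_iff \<Psi>_def)
    qed
    show "\<forall>j\<in>closed_walks d k (tuple_kernel is). (\<lambda>a\<in>{..k}. g (\<Psi> j) a 1) = j"
    proof
      fix j assume j: "j \<in> closed_walks d k (tuple_kernel is)"
      then have "j a = undefined" if "\<not> a \<le> k" for a
        using that walks by (auto simp: PiE_def extensional_def)
      then show "(\<lambda>a\<in>{..k}. g (\<Psi> j) a 1) = j"
        using walk_of[OF j] by (auto simp: fun_eq_iff)
    qed
    show "(\<lambda>f. \<lambda>a\<in>{..k}. g f a 1) ` invariant_colourings d S (s_apply (star_product is)) \<subseteq>
        closed_walks d k (tuple_kernel is)"
    proof clarify
      fix f assume f: "f \<in> invariant_colourings d S (s_apply (star_product is))"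
      have "g f a 1 < d" for a
        using f by (intro g_range) (auto simp: invariant_colourings_def S_def)
      moreover have "g f 0 1 = g f k 1"
        using f by (simp add: g_0 g_k invariant_colourings_def S_def)
      moreover have "g f (t p) 1 = g f (Suc (s p)) 1" if p: "p \<in> set is" for p
      proof -
        have "g f (t p) 1 = f (s_apply (star_product is) (Suc p))"
          using B3[OF p, of f] g_k by simp
        also have "\<dots> = f (Suc p)"
          using f p by (simp add: invariant_colourings_def S_def)
        finally show ?thesis
          using B1[OF p] by simp
      qed
      ultimately show "(\<lambda>a\<in>{..k}. g f a 1) \<in> closed_walks d k (tuple_kernel is)"
        unfolding walks using B2 sk st(2) by (auto simp: less_imp_le Suc_le_eq)
    qed
    show "\<Psi> ` closed_walks d k (tuple_kernel is) \<subseteq> invariant_colourings d S (s_apply (star_product is))"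
    proof clarify
      fix j assume j: "j \<in> closed_walks d k (tuple_kernel is)"
      then have j': "j \<in> {..k} \<rightarrow>\<^sub>E {..<d}" "j 0 = j k" "\<And>p. p \<in> set is \<Longrightarrow> j (t p) = j (Suc (s p))"
        using walks by blast+
      have "\<Psi> j x < d \<and> \<Psi> j (s_apply (star_product is) x) = \<Psi> j x" if x: "x \<in> S" for x
      proof (cases "x = 1")
        case True
        then show ?thesis
          using j' walk_of[OF j, of k] \<Psi>1 by (auto simp: g_k)
      next
        case False
        then obtain p where p: "x = Suc p" "p \<in> set is"
          using x by (auto simp: S_def)
        have "\<Psi> j (s_apply (star_product is) x) = g (\<Psi> j) (t p) 1"
          using B3[OF p(2), of "\<Psi> j"] by (simp add: p(1) g_k)
        also have "\<dots> = j (t p)"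
          using walk_of[OF j] st(2)[OF p(2)] by simp
        finally show ?thesis
          using j'(1) j'(3)[OF p(2)] \<Psi>_Suc[OF p(2)] sk[OF p(2)] by (auto simp: p(1))
      qed
      then show "\<Psi> j \<in> invariant_colourings d S (s_apply (star_product is))"
        by (auto simp: invariant_colourings_def \<Psi>_def)
    qed
  qed
  then show ?thesis
    unfolding k_def S_def by (metis bij_betw_same_card)
qed

text \<open>Supplies a tuple for the choice in \<open>u_fun\<close>, so that
  \<open>u_fun_tuple_kernel\<close> can be used for every partition.\<close>

lemma ex_tuple_kernel_eq:
  assumes "partition_on {1..k} \<pi>"
  shows "\<exists>is. set is \<subseteq> {1..} \<and> length is = k \<and> tuple_kernel is = \<pi>"
proof -
  \<comment> \<open>A point is labelled by the maximum of its block: labels are positive, and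
    different blocks get different labels.\<close>
  define m where "m a = Max {b. \<exists>B\<in>\<pi>. a \<in> B \<and> b \<in> B}" for a
  have sub: "B \<subseteq> {1..k}" "finite B" "B \<noteq> {}" if "B \<in> \<pi>" for B
    using that assms finite_subset[of B "{1..k}"] by (auto simp: partition_on_def)
  have uniq: "B = C" if "B \<in> \<pi>" "C \<in> \<pi>" "a \<in> B" "a \<in> C" for B C a
    using that assms by (meson disjointD disjoint_iff partition_onD2)
  have m: "m a = Max B" if "a \<in> B" "B \<in> \<pi>" for a B
  proof -
    have "{b. \<exists>B\<in>\<pi>. a \<in> B \<and> b \<in> B} = B"
      using that uniq by blast
    then show ?thesis
      by (simp add: m_def)
  qed
  have Max_mem: "Max B \<in> B" if "B \<in> \<pi>" for B
    using sub[OF that] by simp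
  have blocks: "{j \<in> {1..k}. m j = Max B} = B" if B: "B \<in> \<pi>" for B
  proof (intro equalityI subsetI)
    fix j assume j: "j \<in> {j \<in> {1..k}. m j = Max B}"
    moreover have "\<Union> \<pi> = {1..k}"
      using assms by (simp add: partition_on_def)
    ultimately obtain C where C: "j \<in> C" "C \<in> \<pi>"
      by blast
    then have "Max C = Max B"
      using m[of j C] j by simp
    then have "B = C"
      using Max_mem[of C] Max_mem[OF B] uniq[OF B C(2)] C(2) by simp
    then show "j \<in> B"
      using C(1) by simp
  qed (use sub(1)[OF B] B m in auto)
  let ?is = "map m [1..<Suc k]"
  have img: "m ` {1..k} = Max ` \<pi>"
  proof (intro equalityI subsetI)
    fix x assume "x \<in> m ` {1..k}"
    moreover have "\<Union> \<pi> = {1..k}"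
      using assms by (simp add: partition_on_def)
    ultimately obtain a B where "x = m a" "a \<in> B" "B \<in> \<pi>"
      by blast
    then show "x \<in> Max ` \<pi>"
      using m by auto
  next
    fix x assume "x \<in> Max ` \<pi>"
    then obtain B where B: "x = Max B" "B \<in> \<pi>"
      by auto
    then show "x \<in> m ` {1..k}"
      using m[OF Max_mem[OF B(2)] B(2)] Max_mem[OF B(2)] sub(1)[OF B(2)] by (metis image_eqI subsetD)
  qed
  have "set ?is = m ` {1..k}"
    by (auto simp: atLeastLessThanSuc_atLeastAtMost simp del: upt_Suc)
  then have set_is: "set ?is = Max ` \<pi>"
    by (simp only: img)
  have "{j \<in> {1..length ?is}. ?is ! (j - 1) = x} = {j \<in> {1..k}. m j = x}" for x
    by (auto simp del: upt_Suc)
  then have "tuple_kernel ?is = (\<lambda>B. {j \<in> {1..k}. m j = Max B}) ` \<pi>"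
    by (simp only: tuple_kernel_def set_is image_image)
  also have "\<dots> = \<pi>"
    using blocks by force
  finally have "tuple_kernel ?is = \<pi>" .
  moreover have "set ?is \<subseteq> {1..}"
    using Max_mem sub(1) by (subst set_is) force
  ultimately show ?thesis
    by (intro exI[of _ ?is]) auto
qed

text \<open>The relevant point set has \<open>card \<pi> + 1\<close> elements, the centre
  \<open>1\<close> and one point for each block; the formula is
  \<open>card_invariant_colourings\<close> on this set, divided by powers of
  \<open>d\<close>.\<close>

lemma u_fun_pair_partition:
  assumes \<pi>: "\<pi> \<in> pair_partitions k" and d: "1 \<le> d"
  shows "u_fun d \<pi> = of_nat (card (closed_walks d k \<pi>)) / of_nat d ^ Suc (card \<pi>)"
proof -
  obtain "is" where is': "set is \<subseteq> {1..}" "length is = k" "tuple_kernel is = \<pi>"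
    using \<pi> ex_tuple_kernel_eq by (auto simp: pair_partitions_def)
  let ?S = "insert 1 (Suc ` set is)" and ?\<tau> = "star_product is"
  have "inj_on (\<lambda>m. {j \<in> {1..length is}. is ! (j - 1) = m}) (set is)"
  proof (rule inj_onI)
    fix x y assume "x \<in> set is" and
      eq: "{j \<in> {1..length is}. is ! (j - 1) = x} = {j \<in> {1..length is}. is ! (j - 1) = y}"
    then obtain a where "a < length is" "is ! a = x"
      by (auto simp: in_set_conv_nth)
    then have "Suc a \<in> {j \<in> {1..length is}. is ! (j - 1) = x}"
      by simp
    then have "Suc a \<in> {j \<in> {1..length is}. is ! (j - 1) = y}"
      by (simp only: eq)
    then show "x = y"
      using \<open>is ! a = x\<close> by simp
  qed
  then have "card \<pi> = card (set is)"
    unfolding is'(3)[symmetric] tuple_kernel_def by (rule card_image)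
  moreover have "1 \<notin> Suc ` set is"
    using is'(1) by auto
  ultimately have cardS: "card ?S = Suc (card \<pi>)"
    by (simp add: card_image)
  have "card (closed_walks d k \<pi>) * d ^ s_length ?\<tau> = d ^ card ?S"
    using card_closed_walks[of "is" d] card_invariant_colourings[of ?S ?\<tau> d]
      star_product_permutes[of "is" "set is"] is' \<pi>
    by (auto simp: pair_partitions_def)
  then have "of_nat (card (closed_walks d k \<pi>)) * of_nat d ^ s_length ?\<tau> = (of_nat d ^ Suc (card \<pi>) :: complex)"
    unfolding cardS by (metis of_nat_mult of_nat_power)
  moreover have "u_fun d \<pi> = (1 / of_nat d) ^ s_length ?\<tau>"
    using u_fun_tuple_kernel[OF is'(1), of d] by (simp add: is'(3) phi_star_generators star_product_def)
  then have "u_fun d \<pi> * of_nat d ^ s_length ?\<tau> = 1"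
    using d by (simp add: power_one_over)
  ultimately have "u_fun d \<pi> * of_nat d ^ Suc (card \<pi>) = of_nat (card (closed_walks d k \<pi>))"
    by (metis mult.left_commute mult.right_neutral)
  then show ?thesis
    using d by (simp add: eq_divide_eq)
qed

subsection \<open>Wick's formula\<close>

text \<open>Extends \<open>pair_partitions\<close> from \<open>{1..k}\<close> to arbitrary sets,
  because the recursion below removes arbitrary elements.\<close>

definition pairings :: "'a set \<Rightarrow> 'a set set set" where
  "pairings A = {\<pi>. partition_on A \<pi> \<and> (\<forall>B\<in>\<pi>. card B = 2)}"

lemma finite_pairings: "finite A \<Longrightarrow> finite (pairings A)"
  unfolding pairings_def using finitely_many_partition_on by (rule rev_finite_subset) auto

text \<open>Pairings are sorted by the partner \<open>b\<close> of \<open>x\<close>; what remains is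
  any pairing of the other points.\<close>

lemma pairings_insert:
  assumes "x \<notin> A"
  shows "pairings (insert x A) = (\<Union>b\<in>A. insert {x, b} ` pairings (A - {b}))"
proof (intro equalityI subsetI)
  fix \<pi> assume "\<pi> \<in> pairings (insert x A)"
  then have \<pi>: "partition_on (insert x A) \<pi>" "\<And>B. B \<in> \<pi> \<Longrightarrow> card B = 2"
    by (auto simp: pairings_def)
  then obtain B where B: "B \<in> \<pi>" "x \<in> B"
    by (auto simp: partition_on_def)
  then obtain b where b: "B = {x, b}" "x \<noteq> b"
    using \<pi>(2)[OF B(1)] by (auto simp: card_2_iff)
  have "C \<inter> {x, b} = {}" if "C \<in> \<pi> - {{x, b}}" for C
    using disjointD[OF partition_onD2[OF \<pi>(1)], of C B] that B(1) b(1) by simp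
  then have disj: "disjnt {x, b} (\<Union> (\<pi> - {{x, b}}))"
    by (auto simp: disjnt_def)
  have "partition_on (insert x A) (insert {x, b} (\<pi> - {{x, b}}))"
    using \<pi>(1) B(1) b(1) by (simp add: insert_absorb)
  then have "partition_on (insert x A - {x, b}) (\<pi> - {{x, b}})" "{x, b} \<subseteq> insert x A"
    using partition_on_insert[OF disj] by auto
  moreover have "insert x A - {x, b} = A - {b}"
    using assms by auto
  ultimately have "\<pi> - {{x, b}} \<in> pairings (A - {b})" "b \<in> A"
    using \<pi>(2) b(2) by (auto simp: pairings_def)
  then show "\<pi> \<in> (\<Union>b\<in>A. insert {x, b} ` pairings (A - {b}))"
    using B(1) b(1) by (intro UN_I[of b] image_eqI[where x = "\<pi> - {{x, b}}"]) auto
next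
  fix \<pi> assume "\<pi> \<in> (\<Union>b\<in>A. insert {x, b} ` pairings (A - {b}))"
  then obtain b \<rho> where b: "b \<in> A" "\<rho> \<in> pairings (A - {b})" "\<pi> = insert {x, b} \<rho>"
    by auto
  have U: "\<Union> \<rho> = A - {b}"
    using b(2) by (auto simp: pairings_def partition_on_def)
  have "disjnt {x, b} (\<Union> \<rho>)"
    using assms unfolding U by (auto simp: disjnt_def)
  moreover have "insert x A - {x, b} = A - {b}" "x \<noteq> b"
    using assms b(1) by auto
  ultimately show "\<pi> \<in> pairings (insert x A)"
    using b by (auto simp: pairings_def partition_on_insert)
qed

lemma sum_pairings_insert:
  fixes K :: "'a set \<Rightarrow> 'b :: comm_semiring_1"
  assumes "finite A" "x \<notin> A"
  shows "(\<Sum>\<pi>\<in>pairings (insert x A). \<Prod>B\<in>\<pi>. K B) =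
    (\<Sum>b\<in>A. K {x, b} * (\<Sum>\<pi>\<in>pairings (A - {b}). \<Prod>B\<in>\<pi>. K B))"
proof -
  have U: "\<Union> \<rho> = A - {b}" if "\<rho> \<in> pairings (A - {b})" for \<rho> b
    using that by (auto simp: pairings_def partition_on_def)
  have fin: "finite \<rho>" if "\<rho> \<in> pairings (A - {b})" for \<rho> b
    using that assms(1) by (auto simp: pairings_def intro: finite_elements[of "A - {b}"])
  have nmem: "{x, c} \<notin> \<rho>" if "\<rho> \<in> pairings (A - {b})" for \<rho> b c
    using U[OF that] assms(2) by auto
  have "insert {x, b} ` pairings (A - {b}) \<inter> insert {x, c} ` pairings (A - {c}) = {}" if "b \<noteq> c" for b c
  proof -
    have "insert {x, b} \<rho> \<noteq> insert {x, c} \<rho>'" if "\<rho> \<in> pairings (A - {b})" for \<rho> \<rho>'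
      using nmem[OF that, of c] \<open>b \<noteq> c\<close> by (metis doubleton_eq_iff insertE insertI1)
    then show ?thesis
      by blast
  qed
  then have "(\<Sum>\<pi>\<in>pairings (insert x A). \<Prod>B\<in>\<pi>. K B) =
      (\<Sum>b\<in>A. \<Sum>\<pi>\<in>insert {x, b} ` pairings (A - {b}). \<Prod>B\<in>\<pi>. K B)"
    unfolding pairings_insert[OF assms(2)] using assms(1)
    by (intro sum.UNION_disjoint) (auto simp: finite_pairings)
  also have "\<dots> = (\<Sum>b\<in>A. K {x, b} * (\<Sum>\<pi>\<in>pairings (A - {b}). \<Prod>B\<in>\<pi>. K B))"
  proof (rule sum.cong[OF refl])
    fix b assume "b \<in> A"
    have "inj_on (insert {x, b}) (pairings (A - {b}))"
      using nmem by (intro inj_onI) (metis insert_ident)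
    then have "(\<Sum>\<pi>\<in>insert {x, b} ` pairings (A - {b}). \<Prod>B\<in>\<pi>. K B) =
        (\<Sum>\<pi>\<in>pairings (A - {b}). \<Prod>B\<in>insert {x, b} \<pi>. K B)"
      by (simp add: sum.reindex)
    also have "\<dots> = K {x, b} * (\<Sum>\<pi>\<in>pairings (A - {b}). \<Prod>B\<in>\<pi>. K B)"
      using fin nmem by (simp add: sum_distrib_left)
    finally show "(\<Sum>\<pi>\<in>insert {x, b} ` pairings (A - {b}). \<Prod>B\<in>\<pi>. K B) = \<dots>" .
  qed
  finally show ?thesis .
qed

text \<open>Pairing one element with each possible partner removes two elements, so the recursion
  determines \<open>E\<close>. It is assumed only inside \<open>A\<close>, so that in
  \<open>wick_formula\<close> the values of \<open>K\<close> need be known only on pairs from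
  \<open>A\<close>.\<close>

lemma pairing_recursion_unique:
  fixes K :: "'a set \<Rightarrow> 'b :: comm_semiring_1"
  assumes "finite A" and empty: "E {} = 1"
    and rec: "\<And>x A'. insert x A' \<subseteq> A \<Longrightarrow> x \<notin> A' \<Longrightarrow> E (insert x A') = (\<Sum>b\<in>A'. K {x, b} * E (A' - {b}))"
  shows "E A = (\<Sum>\<pi>\<in>pairings A. \<Prod>B\<in>\<pi>. K B)"
proof -
  have "E A' = (\<Sum>\<pi>\<in>pairings A'. \<Prod>B\<in>\<pi>. K B)" if "A' \<subseteq> A" for A'
    using finite_subset[OF that assms(1)] that
  proof (induction A' rule: finite_psubset_induct)
    case (psubset A')
    show ?case
    proof (cases "A' = {}")
      case True
      have "pairings {} = {{} :: 'a set set}"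
        by (auto simp: pairings_def partition_on_empty)
      then show ?thesis
        by (simp add: True empty)
    next
      case False
      then obtain x A'' where A'': "A' = insert x A''" "x \<notin> A''"
        by (meson Set.set_insert all_not_in_conv)
      have "E (A'' - {b}) = (\<Sum>\<pi>\<in>pairings (A'' - {b}). \<Prod>B\<in>\<pi>. K B)" for b
        using A'' psubset.prems by (intro psubset.IH) auto
      then show ?thesis
        using A'' psubset by (simp add: rec sum_pairings_insert)
    qed
  qed
  then show ?thesis
    by simp
qed

lemma sum_PiE_insert:
  assumes "x \<notin> A"
  shows "(\<Sum>g\<in>PiE (insert x A) T. h g) = (\<Sum>y\<in>T x. \<Sum>g\<in>PiE A T. h (g(x := y)))"
  unfolding PiE_insert_eq sum.reindex[OF inj_combinator[OF assms]] sum.cartesian_product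
  by (simp add: case_prod_unfold)

text \<open>Gaussian integration by parts, obtained from the closed forms of the even and odd
  moments. At \<open>n = 0\<close> the truncated \<open>n - 1\<close> is harmless because of the
  factor \<open>real n\<close>.\<close>

lemma normal_moment_Suc:
  assumes "0 < v"
  shows "(LINT x|lborel. normal_density 0 (sqrt v) x * x ^ Suc n) =
    real n * v * (LINT x|lborel. normal_density 0 (sqrt v) x * x ^ (n - 1))"
proof -
  have sqrt: "0 < sqrt v"
    using assms by simp
  have odd: "(LINT x|lborel. normal_density 0 (sqrt v) x * x ^ (2 * m + 1)) = 0" for m
    using integral_normal_moment_odd[OF sqrt, of 0 m] by simp
  have even: "(LINT x|lborel. normal_density 0 (sqrt v) x * x ^ (2 * m)) =
      fact (2 * m) / ((2 / v) ^ m * fact m)" for m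
    using integral_normal_moment_even[OF sqrt, of 0 m] assms by simp
  show ?thesis
  proof (cases "even n")
    case True
    then obtain m where m: "n = 2 * m"
      by blast
    show ?thesis
    proof (cases m)
      case 0
      then show ?thesis
        using odd[of 0] m by simp
    next
      case (Suc l)
      then show ?thesis
        using odd[of m] odd[of l] m by simp
    qed
  next
    case False
    then obtain m where m: "n = 2 * m + 1"
      using oddE by blast
    have alg: "2 * M * N * a / (2 / v * w * (M * b)) = N * v * (a / (w * b))" if "M \<noteq> 0" for M N a b w :: real
      using assms that by (simp add: field_simps)
    have fact2: "fact (2 * Suc m) = 2 * real (Suc m) * real n * fact (2 * m)"
      by (simp add: m algebra_simps)
    have "fact (2 * Suc m) / ((2 / v) ^ Suc m * fact (Suc m)) =
        real n * v * (fact (2 * m) / ((2 / v) ^ m * fact m))"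
      unfolding fact2 power_Suc fact_Suc by (rule alg) simp
    then show ?thesis
      using even[of "Suc m"] even[of m] by (simp add: m)
  qed
qed

section \<open>Independent centred Gaussian variables and their complex linear combinations\<close>

locale gaussian_family = prob_space M for M :: "'w measure" +
  fixes F :: "'e set" and X :: "'e \<Rightarrow> 'w \<Rightarrow> real" and v :: "'e \<Rightarrow> real"
  assumes finite_F: "finite F"
    and indep_X: "indep_vars (\<lambda>_. borel) X F"
    and v_pos: "\<And>e. e \<in> F \<Longrightarrow> 0 < v e"
    and distr_X: "\<And>e. e \<in> F \<Longrightarrow> distributed M lborel (X e) (normal_density 0 (sqrt (v e)))"
begin

lemma integrable_power: "e \<in> F \<Longrightarrow> integrable M (\<lambda>\<omega>. X e \<omega> ^ n)"
  using distributed_integrable[OF distr_X, of e "\<lambda>x. x ^ n"]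
    integrable_normal_moment[of "sqrt (v e)" 0 n] v_pos[of e] by simp

lemma expectation_power:
  "e \<in> F \<Longrightarrow> expectation (\<lambda>\<omega>. X e \<omega> ^ n) = (LINT x|lborel. normal_density 0 (sqrt (v e)) x * x ^ n)"
  using distributed_integral[OF distr_X, of e "\<lambda>x. x ^ n"] by simp

lemma expectation_power_Suc:
  "e \<in> F \<Longrightarrow> expectation (\<lambda>\<omega>. X e \<omega> ^ Suc n) = real n * v e * expectation (\<lambda>\<omega>. X e \<omega> ^ (n - 1))"
  using normal_moment_Suc[OF v_pos] by (simp only: expectation_power)

text \<open>Collecting equal factors leaves one power per variable, and independence lets the
  expectation factor over the variables.\<close>

lemma
  assumes "finite A" "g ` A \<subseteq> F"
  shows integrable_monomial: "integrable M (\<lambda>\<omega>. \<Prod>a\<in>A. X (g a) \<omega>)"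
    and expectation_monomial: "expectation (\<lambda>\<omega>. \<Prod>a\<in>A. X (g a) \<omega>) =
      (\<Prod>e\<in>F. expectation (\<lambda>\<omega>. X e \<omega> ^ card {a\<in>A. g a = e}))"
proof -
  have eq: "(\<Prod>a\<in>A. X (g a) \<omega>) = (\<Prod>e\<in>F. X e \<omega> ^ card {a\<in>A. g a = e})" for \<omega>
  proof -
    have "(\<Prod>a\<in>A. X (g a) \<omega>) = (\<Prod>e\<in>F. \<Prod>a\<in>{a\<in>A. g a = e}. X (g a) \<omega>)"
      using prod.group[OF assms(1) finite_F assms(2), of "\<lambda>a. X (g a) \<omega>"] by simp
    also have "\<dots> = (\<Prod>e\<in>F. \<Prod>a\<in>{a\<in>A. g a = e}. X e \<omega>)"
      by (intro prod.cong) auto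
    finally show ?thesis
      by simp
  qed
  have "indep_vars (\<lambda>_. borel) (\<lambda>e \<omega>. X e \<omega> ^ card {a\<in>A. g a = e}) F"
    by (rule indep_vars_compose2[OF indep_X]) measurable
  then show "integrable M (\<lambda>\<omega>. \<Prod>a\<in>A. X (g a) \<omega>)"
      "expectation (\<lambda>\<omega>. \<Prod>a\<in>A. X (g a) \<omega>) = (\<Prod>e\<in>F. expectation (\<lambda>\<omega>. X e \<omega> ^ card {a\<in>A. g a = e}))"
    unfolding eq using indep_vars_integrable[OF finite_F] indep_vars_lebesgue_integral[OF finite_F]
      integrable_power by blast+
qed

text \<open>Wick's recursion for monomials. Integration by parts in the variable
  \<open>X (g x)\<close> yields the factor \<open>m (g x)\<close>, the number of partners
  \<open>b\<close> carrying the same variable; all of them give the same term, so the factor can be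
  written as a sum over \<open>b\<close>.\<close>

lemma expectation_monomial_insert:
  assumes A: "finite A" "x \<notin> A" and g: "g ` insert x A \<subseteq> F"
  shows "expectation (\<lambda>\<omega>. \<Prod>a\<in>insert x A. X (g a) \<omega>) =
    (\<Sum>b\<in>A. if g b = g x then v (g x) * expectation (\<lambda>\<omega>. \<Prod>a\<in>A - {b}. X (g a) \<omega>) else 0)"
proof -
  define m where "m e = card {a\<in>A. g a = e}" for e
  define R where "R = (\<Prod>e\<in>F - {g x}. expectation (\<lambda>\<omega>. X e \<omega> ^ m e))"
  have gx: "g x \<in> F"
    using g by simp
  have "{a \<in> insert x A. g a = e} = (if e = g x then insert x {a\<in>A. g a = e} else {a\<in>A. g a = e})" for e
    by auto
  then have m_insert: "card {a \<in> insert x A. g a = e} = (if e = g x then Suc (m e) else m e)" for e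
    using A by (simp add: m_def)
  have "expectation (\<lambda>\<omega>. \<Prod>a\<in>insert x A. X (g a) \<omega>) =
      (\<Prod>e\<in>F. expectation (\<lambda>\<omega>. X e \<omega> ^ card {a \<in> insert x A. g a = e}))"
    by (rule expectation_monomial) (use A g in auto)
  also have "\<dots> = (\<Prod>e\<in>F. expectation (\<lambda>\<omega>. X e \<omega> ^ (if e = g x then Suc (m e) else m e)))"
    by (simp only: m_insert)
  also have "\<dots> = expectation (\<lambda>\<omega>. X (g x) \<omega> ^ Suc (m (g x))) * R"
    unfolding R_def by (subst prod.remove[OF finite_F gx]) (auto intro!: prod.cong arg_cong2[where f = "(*)"])
  also have "\<dots> = real (m (g x)) * (v (g x) * (expectation (\<lambda>\<omega>. X (g x) \<omega> ^ (m (g x) - 1)) * R))"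
    by (simp only: expectation_power_Suc[OF gx] mult.assoc)
  also have "\<dots> = (\<Sum>b | b \<in> A \<and> g b = g x. v (g x) * (expectation (\<lambda>\<omega>. X (g x) \<omega> ^ (m (g x) - 1)) * R))"
    by (simp add: m_def)
  also have "\<dots> = (\<Sum>b | b \<in> A \<and> g b = g x. v (g x) * expectation (\<lambda>\<omega>. \<Prod>a\<in>A - {b}. X (g a) \<omega>))"
  proof (rule sum.cong[OF refl])
    fix b assume b: "b \<in> {b. b \<in> A \<and> g b = g x}"
    have "{a \<in> A - {b}. g a = e} = (if e = g x then {a\<in>A. g a = e} - {b} else {a\<in>A. g a = e})" for e
      using b by auto
    then have "card {a \<in> A - {b}. g a = e} = (if e = g x then m e - 1 else m e)" for e
      using b A by (simp add: m_def)
    then have "(\<Prod>e\<in>F. expectation (\<lambda>\<omega>. X e \<omega> ^ card {a \<in> A - {b}. g a = e})) =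
        (\<Prod>e\<in>F. expectation (\<lambda>\<omega>. X e \<omega> ^ (if e = g x then m e - 1 else m e)))"
      by (simp only:)
    also have "\<dots> = expectation (\<lambda>\<omega>. X (g x) \<omega> ^ (m (g x) - 1)) * R"
      unfolding R_def by (subst prod.remove[OF finite_F gx]) (auto intro!: prod.cong arg_cong2[where f = "(*)"])
    also have "(\<Prod>e\<in>F. expectation (\<lambda>\<omega>. X e \<omega> ^ card {a \<in> A - {b}. g a = e})) =
        expectation (\<lambda>\<omega>. \<Prod>a\<in>A - {b}. X (g a) \<omega>)"
      by (rule expectation_monomial[symmetric]) (use A g in auto)
    finally show "v (g x) * (expectation (\<lambda>\<omega>. X (g x) \<omega> ^ (m (g x) - 1)) * R) =
        v (g x) * expectation (\<lambda>\<omega>. \<Prod>a\<in>A - {b}. X (g a) \<omega>)"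
      by simp
  qed
  also have "\<dots> = (\<Sum>b\<in>A. if g b = g x then v (g x) * expectation (\<lambda>\<omega>. \<Prod>a\<in>A - {b}. X (g a) \<omega>) else 0)"
    using A(1) by (intro sum.mono_neutral_cong_left) auto
  finally show ?thesis .
qed

definition lin :: "('e \<Rightarrow> complex) \<Rightarrow> 'w \<Rightarrow> complex" where
  "lin c \<omega> = (\<Sum>e\<in>F. c e * complex_of_real (X e \<omega>))"

text \<open>Bilinear rather than sesquilinear: it is the expectation of \<open>lin c\<close> times
  \<open>lin c'\<close>, without conjugation.\<close>

definition cov :: "('e \<Rightarrow> complex) \<Rightarrow> ('e \<Rightarrow> complex) \<Rightarrow> complex" where
  "cov c c' = (\<Sum>e\<in>F. c e * c' e * complex_of_real (v e))"

lemma prod_lin: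
  assumes "finite A"
  shows "(\<Prod>a\<in>A. lin (c a) \<omega>) =
    (\<Sum>g\<in>A \<rightarrow>\<^sub>E F. (\<Prod>a\<in>A. c a (g a)) * complex_of_real (\<Prod>a\<in>A. X (g a) \<omega>))"
  unfolding lin_def by (simp add: prod_sum_PiE assms finite_F prod.distrib)

lemma integrable_prod_lin:
  assumes "finite A"
  shows "integrable M (\<lambda>\<omega>. \<Prod>a\<in>A. lin (c a) \<omega>)"
  unfolding prod_lin[OF assms] using integrable_monomial[OF assms]
  by (intro Bochner_Integration.integrable_sum integrable_mult_right integrable_of_real) auto

lemma expectation_prod_lin:
  assumes "finite A"
  shows "expectation (\<lambda>\<omega>. \<Prod>a\<in>A. lin (c a) \<omega>) =
    (\<Sum>g\<in>A \<rightarrow>\<^sub>E F. (\<Prod>a\<in>A. c a (g a)) * complex_of_real (expectation (\<lambda>\<omega>. \<Prod>a\<in>A. X (g a) \<omega>)))"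
proof -
  have "integrable M (\<lambda>\<omega>. (\<Prod>a\<in>A. c a (g a)) * complex_of_real (\<Prod>a\<in>A. X (g a) \<omega>))" if "g \<in> A \<rightarrow>\<^sub>E F" for g
    using integrable_monomial[OF assms, of g] that
    by (intro integrable_mult_right integrable_of_real) auto
  then show ?thesis
    unfolding prod_lin[OF assms]
    by (subst Bochner_Integration.integral_sum) (simp_all del: of_real_prod)
qed

text \<open>Multilinear extension of \<open>expectation_monomial_insert\<close>: the products are
  expanded over the functions \<open>g\<close> that choose a variable for each factor.\<close>

lemma expectation_prod_lin_insert:
  fixes A :: "'a set"
  assumes A: "finite A" "x \<notin> A"
  shows "expectation (\<lambda>\<omega>. \<Prod>a\<in>insert x A. lin (c a) \<omega>) =
    (\<Sum>b\<in>A. cov (c x) (c b) * expectation (\<lambda>\<omega>. \<Prod>a\<in>A - {b}. lin (c a) \<omega>))"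
proof -
  define E where "E A g = complex_of_real (expectation (\<lambda>\<omega>. \<Prod>a\<in>A. X (g a) \<omega>))" for A :: "'a set" and g
  have E_cong: "E A g = E A h" if "\<And>a. a \<in> A \<Longrightarrow> g a = h a" for A g h
    using that by (simp add: E_def cong: prod.cong)
  have upd: "(\<Prod>a\<in>B. c a ((g(y := e)) a)) = (\<Prod>a\<in>B. c a (g a))" if "y \<notin> B" for g y e B
    using that by (intro prod.cong) auto
  have "expectation (\<lambda>\<omega>. \<Prod>a\<in>insert x A. lin (c a) \<omega>) =
      (\<Sum>g\<in>insert x A \<rightarrow>\<^sub>E F. (\<Prod>a\<in>insert x A. c a (g a)) * E (insert x A) g)"
    using A by (simp only: expectation_prod_lin finite_insert E_def)
  also have "\<dots> = (\<Sum>e\<in>F. \<Sum>g\<in>A \<rightarrow>\<^sub>E F. (\<Prod>a\<in>insert x A. c a ((g(x := e)) a)) * E (insert x A) (g(x := e)))"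
    by (rule sum_PiE_insert) fact
  also have "\<dots> = (\<Sum>e\<in>F. \<Sum>g\<in>A \<rightarrow>\<^sub>E F. \<Sum>b\<in>A.
      if g b = e then c x e * v e * (\<Prod>a\<in>A. c a (g a)) * E (A - {b}) g else 0)"
  proof (intro sum.cong refl)
    fix e g assume eg: "e \<in> F" "g \<in> A \<rightarrow>\<^sub>E F"
    have "(g(x := e)) ` insert x A \<subseteq> F"
      using eg by auto
    from expectation_monomial_insert[OF A this]
    have "E (insert x A) (g(x := e)) =
        (\<Sum>b\<in>A. if (g(x := e)) b = e then v e * E (A - {b}) (g(x := e)) else 0)"
      by (simp add: E_def if_distrib[of complex_of_real] cong: if_cong)
    also have "\<dots> = (\<Sum>b\<in>A. if g b = e then v e * E (A - {b}) g else 0)"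
    proof (rule sum.cong[OF refl])
      fix b assume "b \<in> A"
      have "E (A - {b}) (g(x := e)) = E (A - {b}) g"
        by (rule E_cong) (use A(2) in auto)
      then show "(if (g(x := e)) b = e then v e * E (A - {b}) (g(x := e)) else 0) =
          (if g b = e then v e * E (A - {b}) g else 0)"
        using A(2) \<open>b \<in> A\<close> by auto
    qed
    finally show "(\<Prod>a\<in>insert x A. c a ((g(x := e)) a)) * E (insert x A) (g(x := e)) =
        (\<Sum>b\<in>A. if g b = e then c x e * v e * (\<Prod>a\<in>A. c a (g a)) * E (A - {b}) g else 0)"
      using A upd[OF A(2), of g e] by (simp add: sum_distrib_left if_distrib mult_ac cong: if_cong)
  qed
  also have "\<dots> = (\<Sum>g\<in>A \<rightarrow>\<^sub>E F. \<Sum>b\<in>A. \<Sum>e\<in>F.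
      if g b = e then c x e * v e * (\<Prod>a\<in>A. c a (g a)) * E (A - {b}) g else 0)"
    unfolding sum.swap[of _ "A \<rightarrow>\<^sub>E F" F] by (rule sum.cong[OF refl], rule sum.swap)
  also have "\<dots> = (\<Sum>b\<in>A. \<Sum>g\<in>A \<rightarrow>\<^sub>E F. \<Sum>e\<in>F.
      if g b = e then c x e * v e * (\<Prod>a\<in>A. c a (g a)) * E (A - {b}) g else 0)"
    by (rule sum.swap)
  also have "\<dots> = (\<Sum>b\<in>A. cov (c x) (c b) * expectation (\<lambda>\<omega>. \<Prod>a\<in>A - {b}. lin (c a) \<omega>))"
  proof (rule sum.cong[OF refl])
    fix b assume b: "b \<in> A"
    have A_eq: "A = insert b (A - {b})"
      using b by auto
    \<comment> \<open>Only \<open>e = g b\<close> survives: \<open>x\<close> and its partner share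
      one variable.\<close>
    have "(\<Sum>g\<in>A \<rightarrow>\<^sub>E F. \<Sum>e\<in>F. if g b = e then c x e * v e * (\<Prod>a\<in>A. c a (g a)) * E (A - {b}) g else 0) =
        (\<Sum>g\<in>A \<rightarrow>\<^sub>E F. c x (g b) * v (g b) * (\<Prod>a\<in>A. c a (g a)) * E (A - {b}) g)"
      using b finite_F by (intro sum.cong refl) (auto simp: sum.delta')
    also have "\<dots> = (\<Sum>g\<in>A \<rightarrow>\<^sub>E F. c x (g b) * c b (g b) * v (g b) *
        ((\<Prod>a\<in>A - {b}. c a (g a)) * E (A - {b}) g))"
    proof -
      have "(\<Prod>a\<in>A. c a (g a)) = c b (g b) * (\<Prod>a\<in>A - {b}. c a (g a))" for g
        by (rule prod.remove[OF A(1) b])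
      then show ?thesis
        by (simp add: mult_ac)
    qed
    also have "\<dots> = (\<Sum>g\<in>insert b (A - {b}) \<rightarrow>\<^sub>E F. c x (g b) * c b (g b) * v (g b) *
        ((\<Prod>a\<in>A - {b}. c a (g a)) * E (A - {b}) g))"
      using A_eq by simp
    \<comment> \<open>The choice at \<open>b\<close> is split off; the expectation over
      \<open>A - {b}\<close> does not depend on it, so the sum factors and the sum over
      \<open>e\<close> becomes the covariance.\<close>
    also have "\<dots> = (\<Sum>e\<in>F. \<Sum>g\<in>A - {b} \<rightarrow>\<^sub>E F. c x e * c b e * v e *
        ((\<Prod>a\<in>A - {b}. c a (g a)) * E (A - {b}) g))"
    proof -
      have "E (A - {b}) (g(b := e)) = E (A - {b}) g" for g e
        by (rule E_cong) auto
      then show ?thesis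
        using upd[of b "A - {b}"] by (subst sum_PiE_insert) (auto simp del: fun_upd_apply simp: fun_upd_same)
    qed
    also have "\<dots> = cov (c x) (c b) * expectation (\<lambda>\<omega>. \<Prod>a\<in>A - {b}. lin (c a) \<omega>)"
      using A(1) by (simp add: cov_def expectation_prod_lin E_def sum_product)
    finally show "(\<Sum>g\<in>A \<rightarrow>\<^sub>E F. \<Sum>e\<in>F.
        if g b = e then c x e * v e * (\<Prod>a\<in>A. c a (g a)) * E (A - {b}) g else 0) = \<dots>" .
  qed
  finally show ?thesis .
qed

text \<open>A function \<open>K\<close> of unordered pairs can express the covariances because
  \<open>cov\<close> is symmetric.\<close>

lemma wick_formula:
  assumes "finite A" and K: "\<And>a b. a \<in> A \<Longrightarrow> b \<in> A \<Longrightarrow> a \<noteq> b \<Longrightarrow> K {a, b} = cov (c a) (c b)"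
  shows "expectation (\<lambda>\<omega>. \<Prod>a\<in>A. lin (c a) \<omega>) = (\<Sum>\<pi>\<in>pairings A. \<Prod>B\<in>\<pi>. K B)"
proof (rule pairing_recursion_unique[where E = "\<lambda>A. expectation (\<lambda>\<omega>. \<Prod>a\<in>A. lin (c a) \<omega>)"])
  fix x A' assume A': "insert x A' \<subseteq> A" "x \<notin> A'"
  then have "finite A'"
    using assms(1) finite_subset by auto
  then have "expectation (\<lambda>\<omega>. \<Prod>a\<in>insert x A'. lin (c a) \<omega>) =
      (\<Sum>b\<in>A'. cov (c x) (c b) * expectation (\<lambda>\<omega>. \<Prod>a\<in>A' - {b}. lin (c a) \<omega>))"
    using A' by (intro expectation_prod_lin_insert)
  also have "\<dots> = (\<Sum>b\<in>A'. K {x, b} * expectation (\<lambda>\<omega>. \<Prod>a\<in>A' - {b}. lin (c a) \<omega>))"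
    using A' by (intro sum.cong refl) (subst K, auto)
  finally show "expectation (\<lambda>\<omega>. \<Prod>a\<in>insert x A'. lin (c a) \<omega>) = \<dots>" .
qed (use assms(1) prob_space in auto)

end

subsection \<open>Entries of word matrices\<close>

definition word_matrix :: "nat \<Rightarrow> (nat \<Rightarrow> complex mat) \<Rightarrow> nat list \<Rightarrow> complex mat" where
  "word_matrix d M is = foldr (\<lambda>n A. M n * A) is (1\<^sub>m d)"

lemma mult_mat_entry:
  assumes "A \<in> carrier_mat d d" "B \<in> carrier_mat d d" "p < d" "q < d"
  shows "(A * B) $$ (p, q) = (\<Sum>l<d. A $$ (p, l) * B $$ (l, q))"
  using assms by (simp add: scalar_prod_def atLeast0LessThan)

context
  fixes d :: nat and M :: "nat \<Rightarrow> complex mat"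
  assumes carrier: "\<And>n. M n \<in> carrier_mat d d"
begin

lemma word_matrix_carrier: "word_matrix d M is \<in> carrier_mat d d"
  unfolding word_matrix_def by (induction "is") (auto intro: mult_carrier_mat carrier)

lemma word_matrix_append: "word_matrix d M (is @ js) = word_matrix d M is * word_matrix d M js"
proof (induction "is")
  case Nil
  then show ?case
    using word_matrix_carrier[of js] by (simp add: word_matrix_def)
next
  case (Cons n "is")
  have "word_matrix d M ((n # is) @ js) = M n * (word_matrix d M is * word_matrix d M js)"
    using Cons by (simp add: word_matrix_def)
  also have "\<dots> = (M n * word_matrix d M is) * word_matrix d M js"
    by (rule assoc_mult_mat[symmetric]) (rule carrier word_matrix_carrier)+
  finally show ?case
    by (simp add: word_matrix_def)
qed

lemma word_matrix_singleton: "word_matrix d M [n] = M n"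
  using carrier[of n] by (simp add: word_matrix_def)

text \<open>Adjoints reverse products, and here all factors are hermitian. In the positivity proof
  this turns the word reversal in \<open>nc_star\<close> into the matrix adjoint.\<close>

lemma word_matrix_rev:
  assumes herm: "\<And>n p q. p < d \<Longrightarrow> q < d \<Longrightarrow> M n $$ (q, p) = cnj (M n $$ (p, q))"
    and "p < d" "q < d"
  shows "word_matrix d M (rev is) $$ (p, q) = cnj (word_matrix d M is $$ (q, p))"
  using assms(2,3)
proof (induction "is" arbitrary: p q)
  case Nil
  then show ?case
    by (auto simp: word_matrix_def)
next
  case (Cons n "is")
  have "word_matrix d M (rev (n # is)) $$ (p, q) = (\<Sum>l<d. word_matrix d M (rev is) $$ (p, l) * M n $$ (l, q))"
    using Cons.prems by (simp add: word_matrix_append word_matrix_singleton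
        mult_mat_entry[OF word_matrix_carrier carrier] del: index_mult_mat)
  also have "\<dots> = cnj (\<Sum>l<d. M n $$ (q, l) * word_matrix d M is $$ (l, p))"
    using Cons by (simp add: herm[of q] mult.commute)
  also have "(\<Sum>l<d. M n $$ (q, l) * word_matrix d M is $$ (l, p)) = word_matrix d M ([n] @ is) $$ (q, p)"
    unfolding word_matrix_append word_matrix_singleton
    using Cons.prems by (simp add: mult_mat_entry[OF carrier word_matrix_carrier] del: index_mult_mat)
  finally show ?case
    by simp
qed

text \<open>Expansion over walks with prescribed end points. The induction appends a letter, so the
  walk gains a last vertex and the earlier ones keep their numbers.\<close>

lemma word_matrix_entry:
  assumes "p < d" "q < d"
  shows "word_matrix d M is $$ (p, q) = (\<Sum>j\<in>{..length is} \<rightarrow>\<^sub>E {..<d}.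
    if j 0 = p \<and> j (length is) = q then \<Prod>a<length is. M (is ! a) $$ (j a, j (Suc a)) else 0)"
  using assms(2)
proof (induction "is" arbitrary: q rule: rev_induct)
  case Nil
  have eq: "(if y = p \<and> y = q then 1 else 0) = (if y = p then if p = q then 1 else 0 else 0 :: complex)" for y
    by simp
  have "{..0::nat} = insert 0 {}"
    by auto
  then have "(\<Sum>j\<in>{..length []} \<rightarrow>\<^sub>E {..<d}. if j 0 = p \<and> j (length []) = q
        then \<Prod>a<length []. M ([] ! a) $$ (j a, j (Suc a)) else 0) =
      (\<Sum>y<d. \<Sum>j\<in>({} :: nat set) \<rightarrow>\<^sub>E {..<d}. if y = p \<and> y = q then 1 else 0)"
    by (simp only: list.size sum_PiE_insert empty_iff not_False_eq_True fun_upd_same lessThan_0 prod.empty)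
  also have "\<dots> = (if p = q then 1 else 0)"
    using assms(1) by (simp add: eq)
  also have "\<dots> = word_matrix d M [] $$ (p, q)"
    using Nil assms(1) by (simp add: word_matrix_def)
  finally show ?case
    by (rule sym)
next
  case (snoc n "is")
  let ?k = "length is"
  let ?P = "\<lambda>j. \<Prod>a<?k. M (is ! a) $$ (j a, j (Suc a))"
  have prod_eq: "(\<Prod>a<Suc ?k. M ((is @ [n]) ! a) $$ ((j(Suc ?k := y)) a, (j(Suc ?k := y)) (Suc a))) =
      ?P j * M n $$ (j ?k, y)" for j y
  proof -
    have "(\<Prod>a<?k. M ((is @ [n]) ! a) $$ ((j(Suc ?k := y)) a, (j(Suc ?k := y)) (Suc a))) = ?P j"
      by (intro prod.cong refl) (simp add: nth_append)
    then show ?thesis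
      by (simp add: nth_append)
  qed
  have "(\<Sum>j\<in>{..Suc ?k} \<rightarrow>\<^sub>E {..<d}.
      if j 0 = p \<and> j (Suc ?k) = q then \<Prod>a<Suc ?k. M ((is @ [n]) ! a) $$ (j a, j (Suc a)) else 0) =
      (\<Sum>y<d. \<Sum>j\<in>{..?k} \<rightarrow>\<^sub>E {..<d}. if j 0 = p \<and> y = q then ?P j * M n $$ (j ?k, y) else 0)"
    unfolding atMost_Suc
    by (subst sum_PiE_insert, simp, simp only: prod_eq) simp
  also have "\<dots> = (\<Sum>j\<in>{..?k} \<rightarrow>\<^sub>E {..<d}. if j 0 = p then ?P j * M n $$ (j ?k, q) else 0)"
  proof -
    have "(\<Sum>y<d. if j 0 = p \<and> y = q then ?P j * M n $$ (j ?k, y) else 0) =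
        (if j 0 = p then ?P j * M n $$ (j ?k, q) else 0)" for j
      using snoc.prems by (cases "j 0 = p") auto
    then show ?thesis
      by (subst sum.swap) simp
  qed
  \<comment> \<open>The last vertex of the shorter walk is made the summation index \<open>l\<close>
    of the matrix product.\<close>
  also have "\<dots> = (\<Sum>j\<in>{..?k} \<rightarrow>\<^sub>E {..<d}. \<Sum>l<d. (if j 0 = p \<and> j ?k = l then ?P j else 0) * M n $$ (l, q))"
  proof (rule sum.cong[OF refl])
    fix j assume j: "j \<in> {..?k} \<rightarrow>\<^sub>E {..<d}"
    then have "j ?k < d"
      by auto
    then show "(if j 0 = p then ?P j * M n $$ (j ?k, q) else 0) =
        (\<Sum>l<d. (if j 0 = p \<and> j ?k = l then ?P j else 0) * M n $$ (l, q))"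
      by (cases "j 0 = p") (auto simp: if_distrib[of "\<lambda>x. x * _"] cong: if_cong)
  qed
  also have "\<dots> = (\<Sum>l<d. word_matrix d M is $$ (p, l) * M n $$ (l, q))"
    by (subst sum.swap) (simp add: snoc.IH sum_distrib_right)
  also have "\<dots> = word_matrix d M (is @ [n]) $$ (p, q)"
    unfolding word_matrix_append word_matrix_singleton
    using assms(1) snoc.prems by (simp add: mult_mat_entry[OF word_matrix_carrier carrier] del: index_mult_mat)
  finally show ?case
    by (simp only: length_append_singleton)
qed

lemma normalized_trace_word_matrix:
  "normalized_trace d (word_matrix d M is) = (\<Sum>j | j \<in> {..length is} \<rightarrow>\<^sub>E {..<d} \<and> j 0 = j (length is).
    \<Prod>a\<in>{1..length is}. M (is ! (a - 1)) $$ (j (a - 1), j a)) / of_nat d"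
proof -
  let ?k = "length is"
  let ?P = "\<lambda>j. \<Prod>a<?k. M (is ! a) $$ (j a, j (Suc a))"
  have "(\<Sum>p<d. word_matrix d M is $$ (p, p)) =
      (\<Sum>j\<in>{..?k} \<rightarrow>\<^sub>E {..<d}. \<Sum>p<d. if j 0 = p \<and> j ?k = p then ?P j else 0)"
    by (subst sum.swap) (simp add: word_matrix_entry)
  also have "\<dots> = (\<Sum>j\<in>{..?k} \<rightarrow>\<^sub>E {..<d}. if j 0 = j ?k then ?P j else 0)"
  proof (rule sum.cong[OF refl])
    fix j assume j: "j \<in> {..?k} \<rightarrow>\<^sub>E {..<d}"
    then have "j 0 < d"
      by auto
    moreover have "(if j 0 = p \<and> j ?k = p then ?P j else 0) = (if p = j 0 then if j 0 = j ?k then ?P j else 0 else 0)" for p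
      by auto
    ultimately show "(\<Sum>p<d. if j 0 = p \<and> j ?k = p then ?P j else 0) = (if j 0 = j ?k then ?P j else 0)"
      by simp
  qed
  also have "\<dots> = (\<Sum>j | j \<in> {..?k} \<rightarrow>\<^sub>E {..<d} \<and> j 0 = j ?k. ?P j)"
    by (rule sum.inter_filter[symmetric]) (simp add: finite_PiE)
  \<comment> \<open>The factors are renumbered from 1 to match the positions that partitions refer
    to.\<close>
  also have "\<dots> = (\<Sum>j | j \<in> {..?k} \<rightarrow>\<^sub>E {..<d} \<and> j 0 = j ?k.
      \<Prod>a\<in>{1..?k}. M (is ! (a - 1)) $$ (j (a - 1), j a))"
    by (simp add: prod.atLeast1_atMost_eq)
  finally show ?thesis
    by (simp add: normalized_trace_def)
qed

end

subsection \<open>Moments of the GUE\<close>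

definition gue_index :: "nat \<Rightarrow> nat \<Rightarrow> (nat \<times> nat \<times> nat + nat \<times> nat \<times> nat) set" where
  "gue_index d r = {(n, i, j). n \<in> {1..r} \<and> i \<le> j \<and> j < d} <+> {(n, i, j). n \<in> {1..r} \<and> i < j \<and> j < d}"

definition gue_variance :: "nat \<Rightarrow> nat \<times> nat \<times> nat + nat \<times> nat \<times> nat \<Rightarrow> real" where
  "gue_variance d e = (case e of
     Inl (n, i, j) \<Rightarrow> if i = j then 1 / real d else 1 / (2 * real d)
   | Inr _ \<Rightarrow> 1 / (2 * real d))"

text \<open>The coefficients of an entry with respect to the independent real variables.
  \<open>min\<close> and \<open>max\<close> send a position below the diagonal to its mirror image,
  where the imaginary part changes sign. For \<open>i = j\<close> the second case yields
  \<open>- \<i>\<close>, but at an index with equal row and column, which \<open>gue_index\<close>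
  excludes.\<close>

definition gue_coeff :: "nat \<Rightarrow> nat \<Rightarrow> nat \<Rightarrow> nat \<times> nat \<times> nat + nat \<times> nat \<times> nat \<Rightarrow> complex" where
  "gue_coeff n i j e = (case e of
     Inl a \<Rightarrow> if a = (n, min i j, max i j) then 1 else 0
   | Inr a \<Rightarrow> if a = (n, min i j, max i j) then if i < j then \<i> else - \<i> else 0)"

lemma finite_index_triples: "finite {(n, i, j). n \<in> {1..r::nat} \<and> i \<le> j \<and> j < (d::nat)}"
    "finite {(n, i, j). n \<in> {1..r::nat} \<and> i < j \<and> j < (d::nat)}"
  by (rule finite_subset[of _ "{1..r} \<times> {..<d} \<times> {..<d}"]; auto)+

lemma finite_gue_index: "finite (gue_index d r)"
  unfolding gue_index_def using finite_index_triples by (rule finite_Plus)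

text \<open>An entry involves at most two variables. The weight \<open>h\<close> is left free: the
  values of the variables give the entry, and variances times a second coefficient give a
  covariance.\<close>

lemma sum_gue_coeff:
  assumes "n \<in> {1..r}" "i < d" "j < d"
  shows "(\<Sum>e\<in>gue_index d r. gue_coeff n i j e * h e) =
    h (Inl (n, min i j, max i j)) +
    (if i = j then 0 else (if i < j then \<i> else - \<i>) * h (Inr (n, min i j, max i j)))"
proof -
  let ?p = "(n, min i j, max i j)"
  have "(\<Sum>a\<in>{(n, i, j). n \<in> {1..r} \<and> i \<le> j \<and> j < d}. gue_coeff n i j (Inl a) * h (Inl a)) =
      (\<Sum>a\<in>{(n, i, j). n \<in> {1..r} \<and> i \<le> j \<and> j < d}. if a = ?p then h (Inl ?p) else 0)"
    by (intro sum.cong) (auto simp: gue_coeff_def)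
  also have "\<dots> = h (Inl ?p)"
    using assms by (subst sum.delta'[OF finite_index_triples(1)] sum.delta[OF finite_index_triples(1)]) auto
  finally have 1: "(\<Sum>a\<in>{(n, i, j). n \<in> {1..r} \<and> i \<le> j \<and> j < d}. gue_coeff n i j (Inl a) * h (Inl a)) = h (Inl ?p)" .
  have "(\<Sum>a\<in>{(n, i, j). n \<in> {1..r} \<and> i < j \<and> j < d}. gue_coeff n i j (Inr a) * h (Inr a)) =
      (\<Sum>a\<in>{(n, i, j). n \<in> {1..r} \<and> i < j \<and> j < d}.
        if a = ?p then (if i < j then \<i> else - \<i>) * h (Inr ?p) else 0)"
    by (intro sum.cong) (auto simp: gue_coeff_def)
  also have "\<dots> = (if i = j then 0 else (if i < j then \<i> else - \<i>) * h (Inr ?p))"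
    using assms by (subst sum.delta[OF finite_index_triples(2)]) auto
  finally have 2: "(\<Sum>a\<in>{(n, i, j). n \<in> {1..r} \<and> i < j \<and> j < d}. gue_coeff n i j (Inr a) * h (Inr a)) =
      (if i = j then 0 else (if i < j then \<i> else - \<i>) * h (Inr ?p))" .
  show ?thesis
    unfolding gue_index_def sum.Plus[OF finite_index_triples] by (simp only: 1 2 comp_def)
qed

locale gue =
  fixes \<Omega> :: "'w measure" and d r :: nat and \<xi> \<eta> :: "nat \<Rightarrow> nat \<Rightarrow> nat \<Rightarrow> 'w \<Rightarrow> real"
  assumes d_pos: "1 \<le> d" and entries: "gue_entries \<Omega> d r \<xi> \<eta>"
begin

sublocale gaussian_family \<Omega> "gue_index d r"
  "case_sum (\<lambda>(n, i, j). \<xi> n i j) (\<lambda>(n, i, j). \<eta> n i j)" "gue_variance d"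
proof -
  interpret prob_space \<Omega>
    using entries by (simp add: gue_entries_def)
  show "gaussian_family \<Omega> (gue_index d r)
      (case_sum (\<lambda>(n, i, j). \<xi> n i j) (\<lambda>(n, i, j). \<eta> n i j)) (gue_variance d)"
  proof
    show "finite (gue_index d r)"
      by (rule finite_gue_index)
    show "indep_vars (\<lambda>_. borel) (case_sum (\<lambda>(n, i, j). \<xi> n i j) (\<lambda>(n, i, j). \<eta> n i j)) (gue_index d r)"
      using entries by (simp add: gue_entries_def gue_index_def)
    show "0 < gue_variance d e" if "e \<in> gue_index d r" for e
      using d_pos by (auto simp: gue_variance_def split: sum.split)
    show "distributed \<Omega> lborel (case_sum (\<lambda>(n, i, j). \<xi> n i j) (\<lambda>(n, i, j). \<eta> n i j) e)
        (normal_density 0 (sqrt (gue_variance d e)))" if "e \<in> gue_index d r" for e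
      using that entries by (auto simp: gue_entries_def gue_index_def gue_variance_def)
  qed
qed

abbreviation gmat :: "'w \<Rightarrow> nat \<Rightarrow> complex mat" where
  "gmat \<omega> n \<equiv> gue_matrix d \<xi> \<eta> n \<omega>"

lemma gmat_carrier: "gmat \<omega> n \<in> carrier_mat d d"
  by (simp add: gue_matrix_def)

lemma gmat_entry:
  assumes "n \<in> {1..r}" "i < d" "j < d"
  shows "gmat \<omega> n $$ (i, j) = lin (gue_coeff n i j) \<omega>"
  unfolding lin_def sum_gue_coeff[OF assms] using assms(2,3)
  by (cases i j rule: linorder_cases)
    (simp_all add: gue_matrix_def complex_eq_iff)

lemma gmat_hermitian: "p < d \<Longrightarrow> q < d \<Longrightarrow> gmat \<omega> n $$ (q, p) = cnj (gmat \<omega> n $$ (p, q))"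
  by (auto simp: gue_matrix_def complex_eq_iff)

text \<open>Off the diagonal, real and imaginary part both have variance \<open>1 / (2 * d)\<close>.
  Their contributions cancel for equal positions, as \<open>\<i>\<close> squared is
  \<open>-1\<close>, and add up to \<open>1 / d\<close> for mirrored ones; on the diagonal the
  single real variable gives \<open>1 / d\<close>.\<close>

lemma cov_gue_coeff:
  assumes "n \<in> {1..r}" "i < d" "j < d"
  shows "cov (gue_coeff n i j) (gue_coeff m k l) = (if n = m \<and> i = l \<and> j = k then 1 / of_nat d else 0)"
proof -
  have "cov (gue_coeff n i j) (gue_coeff m k l) =
      (\<Sum>e\<in>gue_index d r. gue_coeff n i j e * (gue_coeff m k l e * complex_of_real (gue_variance d e)))"
    by (simp add: cov_def mult.assoc)
  also have "\<dots> = (if n = m \<and> i = l \<and> j = k then 1 / of_nat d else 0)"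
    unfolding sum_gue_coeff[OF assms]
    by (cases i j rule: linorder_cases; cases k l rule: linorder_cases)
      (auto simp: gue_coeff_def gue_variance_def min_def max_def field_simps)
  finally show ?thesis .
qed

lemma prod_gmat_entries:
  assumes "set is \<subseteq> {1..r}" "j \<in> {..length is} \<rightarrow>\<^sub>E {..<d}"
  shows "(\<Prod>a\<in>{1..length is}. gmat \<omega> (is ! (a - 1)) $$ (j (a - 1), j a)) =
    (\<Prod>a\<in>{1..length is}. lin (gue_coeff (is ! (a - 1)) (j (a - 1)) (j a)) \<omega>)"
proof (rule prod.cong[OF refl])
  fix a assume a: "a \<in> {1..length is}"
  then have "is ! (a - 1) \<in> set is"
    by (intro nth_mem) auto
  then have "is ! (a - 1) \<in> {1..r}"
    using assms(1) by blast
  moreover have "j (a - 1) < d" "j a < d"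
    using a assms(2) by auto
  ultimately show "gmat \<omega> (is ! (a - 1)) $$ (j (a - 1), j a) =
      lin (gue_coeff (is ! (a - 1)) (j (a - 1)) (j a)) \<omega>"
    by (rule gmat_entry)
qed

lemma trace_word_gmat:
  assumes "set is \<subseteq> {1..r}"
  shows "normalized_trace d (word_matrix d (gmat \<omega>) is) =
    (\<Sum>j | j \<in> {..length is} \<rightarrow>\<^sub>E {..<d} \<and> j 0 = j (length is).
      \<Prod>a\<in>{1..length is}. lin (gue_coeff (is ! (a - 1)) (j (a - 1)) (j a)) \<omega>) / of_nat d"
  unfolding normalized_trace_word_matrix[OF gmat_carrier] using prod_gmat_entries[OF assms] by simp

lemma integrable_trace_word:
  assumes "set is \<subseteq> {1..r}"
  shows "integrable \<Omega> (\<lambda>\<omega>. normalized_trace d (word_matrix d (gmat \<omega>) is))"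
  unfolding trace_word_gmat[OF assms]
  by (intro integrable_divide Bochner_Integration.integrable_sum integrable_prod_lin) simp

lemma gue_moment_word_matrix:
  "gue_moment \<Omega> d \<xi> \<eta> is = expectation (\<lambda>\<omega>. normalized_trace d (word_matrix d (gmat \<omega>) is))"
  by (simp add: gue_moment_def word_matrix_def)

text \<open>Wick's formula is applied to each closed walk, then the sums over walks and pairings are
  exchanged; for a fixed \<open>\<pi>\<close> the walks with a nonzero product of covariances are
  counted by \<open>closed_walks\<close>.\<close>

lemma gue_moment_pairings:
  assumes "set is \<subseteq> {1..r}"
  defines "k \<equiv> length is"
  shows "gue_moment \<Omega> d \<xi> \<eta> is = (\<Sum>\<pi> | \<pi> \<in> pair_partitions k \<and>
      (\<forall>B\<in>\<pi>. \<forall>s\<in>B. \<forall>t\<in>B. s \<noteq> t \<longrightarrow> is ! (s - 1) = is ! (t - 1)). u_fun d \<pi>)"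
proof -
  define same where "same B \<longleftrightarrow> (\<forall>s\<in>B. \<forall>t\<in>B. s \<noteq> t \<longrightarrow> is ! (s - 1) = is ! (t - 1))" for B
  define walk where "walk j B \<longleftrightarrow> (\<forall>s\<in>B. \<forall>t\<in>B. s \<noteq> t \<longrightarrow> j (s - 1) = j t)" for B and j :: "nat \<Rightarrow> nat"
  define J where "J = {j. j \<in> {..k} \<rightarrow>\<^sub>E {..<d} \<and> j 0 = j k}"
  define K where "K j B = (if same B \<and> walk j B then 1 / of_nat d else 0 :: complex)" for j B
  have finJ: "finite J"
    unfolding J_def by (rule finite_subset[OF _ finite_PiE[of "{..k}" "\<lambda>_. {..<d}"]]) auto
  have fin: "finite (pair_partitions k)"
    using finite_pairings[of "{1..k}"] by (simp add: pairings_def pair_partitions_def)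
  have wick: "expectation (\<lambda>\<omega>. \<Prod>a\<in>{1..k}. lin (gue_coeff (is ! (a - 1)) (j (a - 1)) (j a)) \<omega>) =
      (\<Sum>\<pi>\<in>pair_partitions k. \<Prod>B\<in>\<pi>. K j B)" if j: "j \<in> J" for j
  proof -
    have "K j {a, b} = cov (gue_coeff (is ! (a - 1)) (j (a - 1)) (j a)) (gue_coeff (is ! (b - 1)) (j (b - 1)) (j b))"
      if ab: "a \<in> {1..k}" "b \<in> {1..k}" "a \<noteq> b" for a b
    proof -
      have "is ! (a - 1) \<in> set is"
        using ab by (intro nth_mem) (auto simp: k_def)
      then have "is ! (a - 1) \<in> {1..r}"
        using assms(1) by blast
      moreover have "j (a - 1) < d" "j a < d"
        using ab j by (auto simp: J_def)
      moreover have "same {a, b} \<longleftrightarrow> is ! (a - 1) = is ! (b - 1)"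
        using ab(3) unfolding same_def by auto
      \<comment> \<open>For the entries at \<open>(j (a - 1), j a)\<close> and
        \<open>(j (b - 1), j b)\<close> these are the two index equations of
        \<open>cov_gue_coeff\<close>, with the second pair reversed.\<close>
      moreover have "walk j {a, b} \<longleftrightarrow> j (a - 1) = j b \<and> j a = j (b - 1)"
        using ab(3) unfolding walk_def by auto
      ultimately show ?thesis
        unfolding K_def by (simp only: cov_gue_coeff)
    qed
    then show ?thesis
      using wick_formula[of "{1..k}" "K j"] by (simp add: pairings_def pair_partitions_def)
  qed
  have prod_K: "(\<Prod>B\<in>\<pi>. K j B) =
      (if (\<forall>B\<in>\<pi>. same B) \<and> (\<forall>B\<in>\<pi>. walk j B) then 1 / of_nat d ^ card \<pi> else 0)"
    if \<pi>: "\<pi> \<in> pair_partitions k" for \<pi> j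
  proof (cases "\<forall>B\<in>\<pi>. same B \<and> walk j B")
    case True
    then have "(\<Prod>B\<in>\<pi>. K j B) = (\<Prod>B\<in>\<pi>. 1 / of_nat d)"
      by (intro prod.cong) (auto simp: K_def)
    then show ?thesis
      using True by (simp add: power_one_over)
  next
    case False
    moreover have "finite \<pi>"
      using \<pi> finite_elements[of "{1..k}" \<pi>] by (simp add: pair_partitions_def)
    ultimately show ?thesis
      by (auto simp: K_def)
  qed
  have "gue_moment \<Omega> d \<xi> \<eta> is = (\<Sum>j\<in>J. \<Sum>\<pi>\<in>pair_partitions k. \<Prod>B\<in>\<pi>. K j B) / of_nat d"
  proof -
    have "gue_moment \<Omega> d \<xi> \<eta> is =
        (\<Sum>j\<in>J. expectation (\<lambda>\<omega>. \<Prod>a\<in>{1..k}. lin (gue_coeff (is ! (a - 1)) (j (a - 1)) (j a)) \<omega>)) / of_nat d"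
      unfolding gue_moment_word_matrix trace_word_gmat[OF assms(1)] k_def[symmetric] J_def[symmetric]
      by (simp add: integrable_prod_lin)
    also have "(\<Sum>j\<in>J. expectation (\<lambda>\<omega>. \<Prod>a\<in>{1..k}. lin (gue_coeff (is ! (a - 1)) (j (a - 1)) (j a)) \<omega>)) =
        (\<Sum>j\<in>J. \<Sum>\<pi>\<in>pair_partitions k. \<Prod>B\<in>\<pi>. K j B)"
      by (rule sum.cong[OF refl]) (rule wick)
    finally show ?thesis .
  qed
  also have "\<dots> = (\<Sum>\<pi>\<in>pair_partitions k. \<Sum>j\<in>J. (\<Prod>B\<in>\<pi>. K j B) / of_nat d)"
    by (subst sum.swap) (simp add: sum_divide_distrib)
  also have "\<dots> = (\<Sum>\<pi>\<in>pair_partitions k. if \<forall>B\<in>\<pi>. same B then u_fun d \<pi> else 0)"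
  proof (rule sum.cong[OF refl])
    fix \<pi> assume \<pi>: "\<pi> \<in> pair_partitions k"
    have "{j \<in> J. \<forall>B\<in>\<pi>. walk j B} = closed_walks d k \<pi>"
      by (auto simp: J_def walk_def closed_walks_def)
    \<comment> \<open>The exponent \<open>Suc (card \<pi>)\<close> collects one \<open>1 / d\<close>
      for each block and one from the normalized trace.\<close>
    then have "(\<Sum>j\<in>J. if \<forall>B\<in>\<pi>. walk j B then 1 / of_nat d ^ Suc (card \<pi>) else 0) = u_fun d \<pi>"
      using finJ by (simp add: u_fun_pair_partition[OF \<pi> d_pos] flip: sum.inter_filter)
    moreover have "(\<Sum>j\<in>J. (\<Prod>B\<in>\<pi>. K j B) / of_nat d) = (if \<forall>B\<in>\<pi>. same B
        then \<Sum>j\<in>J. if \<forall>B\<in>\<pi>. walk j B then 1 / of_nat d ^ Suc (card \<pi>) else 0 else 0)"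
    proof (cases "\<forall>B\<in>\<pi>. same B")
      case True
      then have "(\<Prod>B\<in>\<pi>. K j B) = (if \<forall>B\<in>\<pi>. walk j B then 1 / of_nat d ^ card \<pi> else 0)" for j
        by (simp add: prod_K[OF \<pi>])
      then have "(\<Prod>B\<in>\<pi>. K j B) / of_nat d = (if \<forall>B\<in>\<pi>. walk j B then 1 / of_nat d ^ Suc (card \<pi>) else 0)" for j
        by (auto simp: mult.commute)
      then show ?thesis
        unfolding if_P[OF True] by simp
    next
      case False
      then have "(\<Prod>B\<in>\<pi>. K j B) = 0" for j
        by (subst prod_K[OF \<pi>]) (use False in auto)
      then show ?thesis
        unfolding if_not_P[OF False] by simp
    qed
    ultimately show "(\<Sum>j\<in>J. (\<Prod>B\<in>\<pi>. K j B) / of_nat d) = (if \<forall>B\<in>\<pi>. same B then u_fun d \<pi> else 0)"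
      by simp
  qed
  also have "\<dots> = (\<Sum>\<pi> | \<pi> \<in> pair_partitions k \<and> (\<forall>B\<in>\<pi>. same B). u_fun d \<pi>)"
    using fin by (simp add: sum.inter_filter)
  finally show ?thesis
    by (simp add: same_def)
qed

end

section \<open>Identification of the GUE moments with \<open>nu_inf_moment\<close>\<close>

lemma partition_on_tuple_kernel: "partition_on {1..length is} (tuple_kernel is)"
proof (rule partition_onI)
  show "\<Union> (tuple_kernel is) = {1..length is}"
    by (rule Union_tuple_kernel)
  show "disjnt B C" if "B \<in> tuple_kernel is" "C \<in> tuple_kernel is" "B \<noteq> C" for B C
    using that by (auto simp: tuple_kernel_def disjnt_def)
  show "{} \<notin> tuple_kernel is"
  proof
    assume "{} \<in> tuple_kernel is"
    then obtain m where m: "m \<in> set is" "{} = {j \<in> {1..length is}. is ! (j - 1) = m}"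
      by (auto simp: tuple_kernel_def)
    then obtain a where "a < length is" "is ! a = m"
      by (auto simp: in_set_conv_nth)
    then have "Suc a \<in> {j \<in> {1..length is}. is ! (j - 1) = m}"
      by simp
    then show False
      using m(2) by blast
  qed
qed

text \<open>Turns the order on partitions into the condition that the covariances leave behind,
  equality of the letters within each block.\<close>

lemma refines_tuple_kernel_iff:
  assumes "partition_on {1..length is} \<pi>"
  shows "refines {1..length is} \<pi> (tuple_kernel is) \<longleftrightarrow>
    (\<forall>B\<in>\<pi>. \<forall>s\<in>B. \<forall>t\<in>B. s \<noteq> t \<longrightarrow> is ! (s - 1) = is ! (t - 1))"
proof -
  have "(\<exists>C\<in>tuple_kernel is. B \<subseteq> C) \<longleftrightarrow> (\<forall>s\<in>B. \<forall>t\<in>B. s \<noteq> t \<longrightarrow> is ! (s - 1) = is ! (t - 1))"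
    if B: "B \<in> \<pi>" for B
  proof
    assume "\<exists>C\<in>tuple_kernel is. B \<subseteq> C"
    then show "\<forall>s\<in>B. \<forall>t\<in>B. s \<noteq> t \<longrightarrow> is ! (s - 1) = is ! (t - 1)"
      by (auto simp: tuple_kernel_def)
  next
    assume *: "\<forall>s\<in>B. \<forall>t\<in>B. s \<noteq> t \<longrightarrow> is ! (s - 1) = is ! (t - 1)"
    have sub: "B \<subseteq> {1..length is}" "B \<noteq> {}"
      using assms B by (auto simp: partition_on_def)
    then obtain s where s: "s \<in> B"
      by blast
    then have "s \<in> {1..length is}"
      using sub(1) by blast
    then have "is ! (s - 1) \<in> set is"
      by (intro nth_mem) auto
    moreover have "B \<subseteq> {j \<in> {1..length is}. is ! (j - 1) = is ! (s - 1)}"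
    proof
      fix t assume t: "t \<in> B"
      then have "t \<in> {1..length is}"
        using sub(1) by blast
      moreover have "is ! (t - 1) = is ! (s - 1)"
        using *[rule_format, OF t s] by (cases "t = s") simp_all
      ultimately show "t \<in> {j \<in> {1..length is}. is ! (j - 1) = is ! (s - 1)}"
        by simp
    qed
    ultimately show "\<exists>C\<in>tuple_kernel is. B \<subseteq> C"
      unfolding tuple_kernel_def by blast
  qed
  then show ?thesis
    using assms partition_on_tuple_kernel by (auto simp: refines_def)
qed

lemma (in gue) gue_moment_eq_nu_inf_moment:
  assumes "set is \<subseteq> {1..r}"
  shows "gue_moment \<Omega> d \<xi> \<eta> is = nu_inf_moment d is"
proof (cases "is = []")
  case True
  have "normalized_trace d (1\<^sub>m d) = 1"
    using d_pos by (simp add: normalized_trace_def)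
  then show ?thesis
    by (simp add: True gue_moment_def nu_inf_moment_def prob_space)
next
  case False
  have "{\<pi>. \<pi> \<in> pair_partitions (length is) \<and> refines {1..length is} \<pi> (tuple_kernel is)} =
      {\<pi>. \<pi> \<in> pair_partitions (length is) \<and>
        (\<forall>B\<in>\<pi>. \<forall>s\<in>B. \<forall>t\<in>B. s \<noteq> t \<longrightarrow> is ! (s - 1) = is ! (t - 1))}"
    by (intro Collect_cong conj_cong refl refines_tuple_kernel_iff) (simp add: pair_partitions_def)
  then show ?thesis
    using False by (simp add: gue_moment_pairings[OF assms] nu_inf_moment_def)
qed

subsection \<open>Linearity and positivity\<close>

text \<open>Lets \<open>P\<close>, \<open>Q\<close> and \<open>P + Q\<close> be summed over one
  common set, since cancellation can make the keys of \<open>P + Q\<close> fewer.\<close>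

lemma linear_extension_superset:
  assumes "finite S" "Poly_Mapping.keys P \<subseteq> S"
  shows "linear_extension f P = (\<Sum>m\<in>S. Poly_Mapping.lookup P m * f m)"
  unfolding linear_extension_def using assms
  by (intro sum.mono_neutral_left) (auto simp: in_keys_iff)

lemma linear_extension_add: "linear_extension f (P + Q) = linear_extension f P + linear_extension f Q"
proof -
  let ?S = "Poly_Mapping.keys P \<union> Poly_Mapping.keys Q"
  have "Poly_Mapping.keys (P + Q) \<subseteq> ?S"
    by (rule Poly_Mapping.keys_add)
  then show ?thesis
    using linear_extension_superset[of ?S P f] linear_extension_superset[of ?S Q f]
      linear_extension_superset[of ?S "P + Q" f]
    by (simp add: lookup_add distrib_right sum.distrib)
qed

lemma lookup_map_mult:
  fixes c :: "'b :: semiring_0"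
  shows "Poly_Mapping.lookup (Poly_Mapping.map ((*) c) P) m = c * Poly_Mapping.lookup P m"
  by (simp add: Poly_Mapping.map.rep_eq when_def)

lemma keys_map_mult:
  fixes c :: "'b :: semiring_0"
  shows "Poly_Mapping.keys (Poly_Mapping.map ((*) c) P) \<subseteq> Poly_Mapping.keys P"
  by (auto simp: in_keys_iff lookup_map_mult)

lemma linear_extension_scale: "linear_extension f (Poly_Mapping.map ((*) c) P) = c * linear_extension f P"
  using linear_extension_superset[OF finite_keys keys_map_mult, of f c P]
  by (simp add: linear_extension_def lookup_map_mult sum_distrib_left mult.assoc)

lemma linear_extension_sum: "linear_extension f (sum P I) = (\<Sum>i\<in>I. linear_extension f (P i))"
proof (induction I rule: infinite_finite_induct)
qed (simp_all add: linear_extension_add, simp_all add: linear_extension_def)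

lemma poly_mapping_eq_sum_single:
  "P = (\<Sum>m\<in>Poly_Mapping.keys P. Poly_Mapping.single m (Poly_Mapping.lookup P m))"
proof (rule poly_mapping_eqI)
  fix k
  show "Poly_Mapping.lookup P k =
      Poly_Mapping.lookup (\<Sum>m\<in>Poly_Mapping.keys P. Poly_Mapping.single m (Poly_Mapping.lookup P m)) k"
    by (simp add: lookup_sum lookup_single when_def in_keys_iff)
qed

lemma linear_extension_mult:
  "linear_extension f (P * Q) = (\<Sum>u\<in>Poly_Mapping.keys P. \<Sum>v\<in>Poly_Mapping.keys Q.
     Poly_Mapping.lookup P u * Poly_Mapping.lookup Q v * f (u + v))"
proof -
  have "P * Q = (\<Sum>u\<in>Poly_Mapping.keys P. Poly_Mapping.single u (Poly_Mapping.lookup P u)) *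
      (\<Sum>v\<in>Poly_Mapping.keys Q. Poly_Mapping.single v (Poly_Mapping.lookup Q v))"
    by (simp flip: poly_mapping_eq_sum_single)
  also have "\<dots> = (\<Sum>u\<in>Poly_Mapping.keys P. \<Sum>v\<in>Poly_Mapping.keys Q.
      Poly_Mapping.single (u + v) (Poly_Mapping.lookup P u * Poly_Mapping.lookup Q v))"
    by (simp add: sum_product mult_single)
  finally show ?thesis
    by (simp add: linear_extension_sum linear_extension_single)
qed

text \<open>Word reversal is an involution that carries the keys of \<open>P\<close> to those of
  \<open>nc_star P\<close>; after reindexing, both sums run over the keys of \<open>P\<close> and
  the sesquilinear form is visible.\<close>

lemma linear_extension_star_mult:
  "linear_extension f (nc_star P * P) = (\<Sum>u\<in>Poly_Mapping.keys P. \<Sum>v\<in>Poly_Mapping.keys P.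
     cnj (Poly_Mapping.lookup P u) * Poly_Mapping.lookup P v * f (Word (rev (letters u) @ letters v)))"
proof -
  let ?rev = "\<lambda>w. Word (rev (letters w))"
  have lookup: "Poly_Mapping.lookup (nc_star P) w = cnj (Poly_Mapping.lookup P (?rev w))" for w
    by (simp add: nc_star.rep_eq)
  have rev_rev: "?rev (?rev w) = w" for w
    by simp
  have "Poly_Mapping.keys (nc_star P) = ?rev ` Poly_Mapping.keys P"
  proof (intro equalityI subsetI)
    fix w assume "w \<in> Poly_Mapping.keys (nc_star P)"
    then have "?rev w \<in> Poly_Mapping.keys P"
      by (simp add: in_keys_iff lookup)
    then show "w \<in> ?rev ` Poly_Mapping.keys P"
      by (rule rev_image_eqI) simp
  qed (auto simp: in_keys_iff lookup)
  moreover have "inj_on ?rev (Poly_Mapping.keys P)"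
    by (metis (no_types, lifting) inj_onI rev_rev)
  ultimately show ?thesis
    unfolding linear_extension_mult by (simp add: sum.reindex lookup plus_nc_word_def)
qed

lemma linear_functional_on_linear_extension: "linear_functional_on A (linear_extension f)"
  by (simp add: linear_functional_on_def linear_extension_add linear_extension_scale)

lemma linear_extension_cong:
  assumes "P \<in> nc_polys I" "\<And>is. set is \<subseteq> I \<Longrightarrow> f (Word is) = g (Word is)"
  shows "linear_extension f P = linear_extension g P"
  unfolding linear_extension_def
proof (rule sum.cong[OF refl])
  fix w assume "w \<in> Poly_Mapping.keys P"
  then have "set (letters w) \<subseteq> I"
    using assms(1) by (auto simp: nc_polys_def)
  from assms(2)[OF this] show "Poly_Mapping.lookup P w * f w = Poly_Mapping.lookup P w * g w"
    by simp
qed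

lemma nc_polys_add: "P \<in> nc_polys I \<Longrightarrow> Q \<in> nc_polys I \<Longrightarrow> P + Q \<in> nc_polys I"
  using Poly_Mapping.keys_add[of P Q] by (force simp: nc_polys_def)

lemma nc_polys_scale: "P \<in> nc_polys I \<Longrightarrow> Poly_Mapping.map ((*) c) P \<in> nc_polys I"
  using keys_map_mult[of c P] by (force simp: nc_polys_def)

lemma nc_polys_one: "1 \<in> nc_polys I"
  by (auto simp: nc_polys_def zero_nc_word_def)

lemma nc_polys_star_mult:
  assumes "P \<in> nc_polys I"
  shows "nc_star P * P \<in> nc_polys I"
proof -
  have "set (letters w) \<subseteq> I" if "w \<in> Poly_Mapping.keys (nc_star P)" for w
  proof -
    have "Word (rev (letters w)) \<in> Poly_Mapping.keys P"
      using that by (simp add: in_keys_iff nc_star.rep_eq)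
    then show ?thesis
      using assms by (force simp: nc_polys_def)
  qed
  then have "\<forall>w\<in>Poly_Mapping.keys (nc_star P * P). set (letters w) \<subseteq> I"
    using keys_mult[of "nc_star P" P] assms by (fastforce simp: nc_polys_def plus_nc_word_def)
  then show ?thesis
    by (simp add: nc_polys_def)
qed

section \<open>Positivity of the GUE moments\<close>

lemma sum_swap_pairs:
  "(\<Sum>p\<in>A. \<Sum>q\<in>B. \<Sum>u\<in>C. \<Sum>v\<in>D. t p q u v) = (\<Sum>u\<in>C. \<Sum>v\<in>D. \<Sum>p\<in>A. \<Sum>q\<in>B. t p q u v)"
proof -
  have "(\<Sum>p\<in>A. \<Sum>q\<in>B. \<Sum>u\<in>C. \<Sum>v\<in>D. t p q u v) = (\<Sum>p\<in>A. \<Sum>u\<in>C. \<Sum>q\<in>B. \<Sum>v\<in>D. t p q u v)"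
    by (rule sum.cong[OF refl], rule sum.swap)
  also have "\<dots> = (\<Sum>u\<in>C. \<Sum>p\<in>A. \<Sum>q\<in>B. \<Sum>v\<in>D. t p q u v)"
    by (rule sum.swap)
  also have "\<dots> = (\<Sum>u\<in>C. \<Sum>p\<in>A. \<Sum>v\<in>D. \<Sum>q\<in>B. t p q u v)"
    by (rule sum.cong[OF refl], rule sum.cong[OF refl], rule sum.swap)
  also have "\<dots> = (\<Sum>u\<in>C. \<Sum>v\<in>D. \<Sum>p\<in>A. \<Sum>q\<in>B. t p q u v)"
    by (rule sum.cong[OF refl], rule sum.swap)
  finally show ?thesis .
qed

text \<open>For each \<open>\<omega>\<close> the integrand equals \<open>h \<omega>\<close>, the
  squared Frobenius norm, divided by \<open>d\<close>, of the matrix obtained by substituting the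
  GUE matrices into \<open>P\<close>.\<close>

lemma (in gue) gue_moment_positive:
  assumes P: "P \<in> nc_polys {1..r}"
  shows "linear_extension (\<lambda>w. gue_moment \<Omega> d \<xi> \<eta> (letters w)) (nc_star P * P) \<in> \<real>\<^sub>\<ge>\<^sub>0"
proof -
  let ?K = "Poly_Mapping.keys P" and ?c = "Poly_Mapping.lookup P"
  let ?W = "\<lambda>\<omega> w. word_matrix d (gmat \<omega>) (letters w)"
  define h where "h \<omega> = (\<Sum>p<d. \<Sum>q<d. (norm (\<Sum>v\<in>?K. ?c v * ?W \<omega> v $$ (q, p)))\<^sup>2) / real d" for \<omega>
  have letters: "set (rev (letters u) @ letters v) \<subseteq> {1..r}" if "u \<in> ?K" "v \<in> ?K" for u v
    using P that by (auto simp: nc_polys_def)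
  have trace: "normalized_trace d (word_matrix d (gmat \<omega>) (rev (letters u) @ letters v)) =
      (\<Sum>p<d. \<Sum>q<d. cnj (?W \<omega> u $$ (q, p)) * ?W \<omega> v $$ (q, p)) / of_nat d" for \<omega> u v
    unfolding normalized_trace_def word_matrix_append[OF gmat_carrier]
    by (simp add: mult_mat_entry[OF word_matrix_carrier word_matrix_carrier, OF gmat_carrier gmat_carrier]
        del: index_mult_mat) (simp add: word_matrix_rev[OF gmat_carrier gmat_hermitian])
  have "linear_extension (\<lambda>w. gue_moment \<Omega> d \<xi> \<eta> (letters w)) (nc_star P * P) =
      (\<Sum>u\<in>?K. \<Sum>v\<in>?K. cnj (?c u) * ?c v *
        expectation (\<lambda>\<omega>. normalized_trace d (word_matrix d (gmat \<omega>) (rev (letters u) @ letters v))))"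
    by (simp add: linear_extension_star_mult gue_moment_word_matrix)
  also have "\<dots> = expectation (\<lambda>\<omega>. \<Sum>u\<in>?K. \<Sum>v\<in>?K. cnj (?c u) * ?c v *
      normalized_trace d (word_matrix d (gmat \<omega>) (rev (letters u) @ letters v)))"
    using integrable_trace_word[OF letters]
    by (simp add: Bochner_Integration.integral_sum Bochner_Integration.integrable_sum)
  also have "\<dots> = expectation (\<lambda>\<omega>. complex_of_real (h \<omega>))"
  proof -
    have "(\<Sum>u\<in>?K. \<Sum>v\<in>?K. cnj (?c u) * ?c v *
        normalized_trace d (word_matrix d (gmat \<omega>) (rev (letters u) @ letters v))) = complex_of_real (h \<omega>)" for \<omega>
    proof -
      have "complex_of_real (h \<omega>) = (\<Sum>p<d. \<Sum>q<d. \<Sum>u\<in>?K. \<Sum>v\<in>?K.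
          cnj (?c u) * ?c v * (cnj (?W \<omega> u $$ (q, p)) * ?W \<omega> v $$ (q, p))) / of_nat d"
      proof -
        have norm: "complex_of_real ((norm z)\<^sup>2) = cnj z * z" for z
          by (simp add: complex_norm_square mult.commute del: of_real_power)
        have "complex_of_real ((norm (\<Sum>v\<in>?K. ?c v * ?W \<omega> v $$ (q, p)))\<^sup>2) = (\<Sum>u\<in>?K. \<Sum>v\<in>?K.
            cnj (?c u) * ?c v * (cnj (?W \<omega> u $$ (q, p)) * ?W \<omega> v $$ (q, p)))" for p q
          unfolding norm cnj_sum sum_product by (simp add: mult_ac)
        then show ?thesis
          unfolding h_def by (simp del: of_real_power)
      qed
      also have "(\<Sum>p<d. \<Sum>q<d. \<Sum>u\<in>?K. \<Sum>v\<in>?K.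
          cnj (?c u) * ?c v * (cnj (?W \<omega> u $$ (q, p)) * ?W \<omega> v $$ (q, p))) =
          (\<Sum>u\<in>?K. \<Sum>v\<in>?K. \<Sum>p<d. \<Sum>q<d.
          cnj (?c u) * ?c v * (cnj (?W \<omega> u $$ (q, p)) * ?W \<omega> v $$ (q, p)))"
        by (rule sum_swap_pairs)
      finally show ?thesis
        by (simp add: trace sum_distrib_left sum_divide_distrib)
    qed
    then show ?thesis
      by simp
  qed
  also have "\<dots> = complex_of_real (expectation h)"
    by simp
  finally show ?thesis
    by (simp add: h_def sum_nonneg)
qed

section \<open>A concrete probability space carrying GUE entries\<close>

definition gaussian_product :: "nat \<Rightarrow> nat \<Rightarrow> (nat \<times> nat \<times> nat + nat \<times> nat \<times> nat \<Rightarrow> real) measure" where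
  "gaussian_product d r =
     PiM (gue_index d r) (\<lambda>e. density lborel (normal_density 0 (sqrt (gue_variance d e))))"

text \<open>The coordinates of a product measure are independent with the factors as their laws.
  This model is what allows \<open>nu_inf_positive\<close> to be stated without a given sample
  space.\<close>

lemma gue_entries_gaussian_product:
  assumes "1 \<le> d" "1 \<le> r"
  shows "gue_entries (gaussian_product d r) d r (\<lambda>n i j \<omega>. \<omega> (Inl (n, i, j))) (\<lambda>n i j \<omega>. \<omega> (Inr (n, i, j)))"
proof -
  let ?F = "gue_index d r" and ?M = "gaussian_product d r"
  let ?N = "\<lambda>e. density lborel (normal_density 0 (sqrt (gue_variance d e)))"
  have prob: "prob_space (?N e)" for e
    using assms by (intro prob_space_normal_density) (auto simp: gue_variance_def split: sum.split)
  interpret prob_space ?M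
    unfolding gaussian_product_def by (intro prob_space_PiM prob)
  have meas: "random_variable borel (\<lambda>\<omega>. \<omega> e)" if "e \<in> ?F" for e
    using measurable_component_singleton[OF that, of ?N] by (simp add: gaussian_product_def)
  have distr: "distr ?M borel (\<lambda>\<omega>. \<omega> e) = ?N e" if "e \<in> ?F" for e
  proof -
    have "distr ?M borel (\<lambda>\<omega>. \<omega> e) = distr ?M (?N e) (\<lambda>\<omega>. \<omega> e)"
      by (rule distr_cong) auto
    then show ?thesis
      using distr_PiM_component[OF prob that] by (simp add: gaussian_product_def)
  qed
  have distributed: "distributed ?M lborel (\<lambda>\<omega>. \<omega> e) (normal_density 0 (sqrt (gue_variance d e)))"
    if "e \<in> ?F" for e
    using distr[OF that] meas[OF that] by (simp add: distributed_def cong: distr_cong)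
  have "indep_vars (\<lambda>_. borel) (\<lambda>e \<omega>. \<omega> e) ?F"
  proof (subst indep_vars_iff_distr_eq_PiM')
    \<comment> \<open>The independence criterion asks for a nonempty family;
      \<open>1 \<le> d\<close> and \<open>1 \<le> r\<close> provide this variable.\<close>
    have "Inl (1, 0, 0) \<in> ?F"
      using assms by (auto simp: gue_index_def)
    then show "?F \<noteq> {}"
      by blast
    have sets: "sets (PiM ?F (\<lambda>_. borel)) = sets ?M"
      unfolding gaussian_product_def by (intro sets_PiM_cong) auto
    \<comment> \<open>Points of the product space are already extensional, so restricting them to
      \<open>?F\<close> is the identity.\<close>
    have "distr ?M (PiM ?F (\<lambda>_. borel)) (\<lambda>\<omega>. \<lambda>e\<in>?F. \<omega> e) = distr ?M ?M (\<lambda>\<omega>. \<omega>)"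
      by (intro distr_cong sets) (auto simp: gaussian_product_def space_PiM)
    also have "\<dots> = PiM ?F ?N"
      by (simp add: distr_id gaussian_product_def)
    also have "\<dots> = PiM ?F (\<lambda>e. distr ?M borel (\<lambda>\<omega>. \<omega> e))"
      by (intro PiM_cong) (simp_all add: distr)
    finally show "distr ?M (PiM ?F (\<lambda>_. borel)) (\<lambda>\<omega>. \<lambda>e\<in>?F. \<omega> e) = PiM ?F (\<lambda>e. distr ?M borel (\<lambda>\<omega>. \<omega> e))" .
  qed (rule meas)
  moreover have "case_sum (\<lambda>(n, i, j) \<omega>. \<omega> (Inl (n, i, j))) (\<lambda>(n, i, j) \<omega>. \<omega> (Inr (n, i, j))) = (\<lambda>e (\<omega> :: nat \<times> nat \<times> nat + nat \<times> nat \<times> nat \<Rightarrow> real). \<omega> e)"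
    by (auto simp: fun_eq_iff split: sum.split)
  ultimately have indep: "indep_vars (\<lambda>_. borel)
      (case_sum (\<lambda>(n, i, j) \<omega>. \<omega> (Inl (n, i, j))) (\<lambda>(n, i, j) \<omega>. \<omega> (Inr (n, i, j)))) ?F"
    by simp
  show ?thesis
    unfolding gue_entries_def
  proof (intro conjI ballI allI impI)
    fix n i assume "n \<in> {1..r}" "i < d"
    then have "Inl (n, i, i) \<in> ?F"
      by (auto simp: gue_index_def)
    from distributed[OF this]
    show "distributed ?M lborel (\<lambda>\<omega>. \<omega> (Inl (n, i, i))) (normal_density 0 (sqrt (1 / real d)))"
      by (simp add: gue_variance_def)
  next
    fix n i j assume "n \<in> {1..r}" and ij: "i < j \<and> j < d"
    then have "Inl (n, i, j) \<in> ?F" "Inr (n, i, j) \<in> ?F"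
      by (auto simp: gue_index_def)
    from distributed[OF this(1)] distributed[OF this(2)] ij
    show "distributed ?M lborel (\<lambda>\<omega>. \<omega> (Inl (n, i, j))) (normal_density 0 (sqrt (1 / (2 * real d))))"
        "distributed ?M lborel (\<lambda>\<omega>. \<omega> (Inr (n, i, j))) (normal_density 0 (sqrt (1 / (2 * real d))))"
      by (simp_all add: gue_variance_def)
  qed (use prob_space_axioms indep in \<open>simp_all only: gue_index_def\<close>)
qed

section \<open>Reduction to finitely many indeterminates and conclusion\<close>

lemma nc_polys_finitely_many_variables:
  assumes "P \<in> nc_polys {1..}"
  shows "\<exists>r\<ge>1. P \<in> nc_polys {1..r}"
proof -
  \<comment> \<open>Inserting \<open>1\<close> keeps the set nonempty and gives
    \<open>1 \<le> r\<close> even when \<open>P\<close> is constant.\<close>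
  let ?L = "insert 1 (\<Union>w\<in>Poly_Mapping.keys P. set (letters w))"
  have "P \<in> nc_polys {1..Max ?L}"
    using assms by (fastforce simp: nc_polys_def intro: Max_ge)
  moreover have "1 \<le> Max ?L"
    by (intro Max_ge) auto
  ultimately show ?thesis
    by blast
qed

lemma (in gue) nu_inf_eq_gue:
  "P \<in> nc_polys {1..r} \<Longrightarrow>
    nu_inf d P = linear_extension (\<lambda>w. gue_moment \<Omega> d \<xi> \<eta> (letters w)) P"
  unfolding nu_inf_def by (rule linear_extension_cong, assumption) (simp only: nc_word.sel gue_moment_eq_nu_inf_moment)

text \<open>The number \<open>r\<close> of matrices depends on \<open>P\<close>, and the model
  supplies a GUE for each \<open>r\<close>. As \<open>nc_star P * P\<close> contains no further
  indeterminates, the same \<open>r\<close> serves for it.\<close>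

lemma nu_inf_positive:
  assumes "1 \<le> d"
  shows "positive_functional_on (nc_polys {1..}) (nu_inf d)"
  unfolding positive_functional_on_def
proof
  fix P assume "P \<in> nc_polys {1..}"
  then obtain r where r: "1 \<le> r" "P \<in> nc_polys {1..r}"
    using nc_polys_finitely_many_variables by blast
  interpret gue "gaussian_product d r" d r "\<lambda>n i j \<omega>. \<omega> (Inl (n, i, j))" "\<lambda>n i j \<omega>. \<omega> (Inr (n, i, j))"
    using assms r gue_entries_gaussian_product by unfold_locales
  show "nu_inf d (nc_star P * P) \<in> \<real>\<^sub>\<ge>\<^sub>0"
    using nu_inf_eq_gue[OF nc_polys_star_mult[OF r(2)]] gue_moment_positive[OF r(2)] by simp
qed

lemma (in gue) gue_distribution_in_distributions:
  "gue_distribution \<Omega> d r \<xi> \<eta> \<in> distributions r"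
proof -
  let ?\<mu> = "linear_extension (\<lambda>w. gue_moment \<Omega> d \<xi> \<eta> (letters w))"
  have "?\<mu> 1 = 1"
    using gue_moment_eq_nu_inf_moment[of "[]"]
    by (simp add: nu_inf_moment_def linear_extension_single zero_nc_word_def flip: single_one)
  then show ?thesis
    using gue_moment_positive
    by (simp add: distributions_def gue_distribution_def linear_functional_on_def positive_functional_on_def
        nc_polys_add nc_polys_scale nc_polys_one nc_polys_star_mult linear_extension_add linear_extension_scale)
qed

theorem proposition1p12:
  fixes d r :: nat
  assumes "1 \<le> d" "1 \<le> r"
  shows "linear_functional_on (nc_polys {1..}) (nu_inf d) \<and>
    positive_functional_on (nc_polys {1..}) (nu_inf d) \<and>
    (\<forall>(\<Omega> :: 'w measure) \<xi> \<eta>. gue_entries \<Omega> d r \<xi> \<eta> \<longrightarrow>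
       restrict (nu_inf d) (nc_polys {1..r}) = gue_distribution \<Omega> d r \<xi> \<eta> \<and>
       gue_distribution \<Omega> d r \<xi> \<eta> \<in> distributions r)"
proof (intro conjI allI impI)
  show "linear_functional_on (nc_polys {1..}) (nu_inf d)"
    unfolding nu_inf_def by (rule linear_functional_on_linear_extension)
  show "positive_functional_on (nc_polys {1..}) (nu_inf d)"
    using assms(1) by (rule nu_inf_positive)
next
  fix \<Omega> :: "'w measure" and \<xi> \<eta>
  assume "gue_entries \<Omega> d r \<xi> \<eta>"
  then interpret gue \<Omega> d r \<xi> \<eta>
    using assms(1) by unfold_locales
  show "restrict (nu_inf d) (nc_polys {1..r}) = gue_distribution \<Omega> d r \<xi> \<eta>"
    unfolding gue_distribution_def using nu_inf_eq_gue by (intro restrict_ext)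
  show "gue_distribution \<Omega> d r \<xi> \<eta> \<in> distributions r"
    by (rule gue_distribution_in_distributions)
qed

end
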